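(* Let $a,b,c$ be arbitrary nonzero constants, and consider the $(2+1)$-dimensional extended Boiti-Leon-Manna-Pempinelli system for $u=u(x,y,t)$, $v=v(x,y,t)$: $$u_{ty}-a u_{xy}-b u_{yy}+u_{xxxy}+c\,(u_{yyyy}-6v u_{yy})-3(u_y u_{xx}+u_x u_{xy})=0,\qquad u_{yy}-v_x=0.$$ Assume that the arbitrary functions $F_1(t),F_2(t),F_3(t)$ appearing in its infinitesimal symmetries (see context) are constants. Then the Lie algebra $L_5$ formed by the infinitesimal symmetries of this system is five-dimensional and is spanned by the vector fields $$v_1=\tfrac13 x\,\partial_x+\tfrac13 y\,\partial_y+t\,\partial_t+\frac{-2ax-3u}{9}\,\partial_u+\frac{-12cv-2b}{18c}\,\partial_v,$$ $$v_2=\partial_t,\qquad v_3=\partial_x,\qquad v_4=\partial_y,\qquad v_5=\partial_u.$$ In particular $v_1,\dots,v_5$ are linearly independent, and any infinitesimal symmetry of the system is a linear combination $a_1v_1+a_2v_2+a_3v_3+a_4v_4+a_5v_5$ with constant coefficients $a_1,\dots,a_5$.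
   Context: A vector field $Z=\xi_x\partial_x+\xi_y\partial_y+\xi_t\partial_t+\eta_u\partial_u+\eta_v\partial_v$, with coefficients functions of $(x,y,t,u,v)$ (the subscripts on $\xi,\eta$ are labels, not derivatives), is an infinitesimal (Lie point) symmetry of the system $\Delta_1=0,\ \Delta_2=0$ (the two equations above) if its fourth prolongation satisfies $\mathrm{Pr}^{(4)}Z(\Delta_i)=0$, $i=1,2$, on solutions of the system. Solving the resulting determining equations gives $\xi_x=\tfrac13 g_1x+F_1(t)$, $\xi_y=\tfrac13 g_1y+F_2(t)$, $\xi_t=g_1t+g_2$, with $g_1,g_2$ arbitrary constants and $F_1,F_2$ arbitrary functions of $t$; a third arbitrary function $F_3(t)$ enters $\eta_u$ additively. When $F_1=g_3$, $F_2=g_4$, $F_3=g_5$ are constants, the remaining coefficients are $\eta_u=g_5+\tfrac19(-2ax-3u)g_1$ and $\eta_v=\frac{(-12cv-2b)g_1}{18c}$. The Lie bracket is the commutator of vector fields on the space with coordinates $(x,y,t,u,v)$. *)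

theory Defs
  imports "HOL-Analysis.Analysis" "HOL-Library.Function_Algebras"
begin

section \<open>Smooth maps\<close>

definition dderiv ::
  "'a::euclidean_space \<Rightarrow> ('a \<Rightarrow> 'b::real_normed_vector) \<Rightarrow> 'a \<Rightarrow> 'b" where
  "dderiv e f = (\<lambda>p. frechet_derivative f (at p) e)"

text \<open>For open \<open>S\<close> this is \<open>C\<^sup>\<infinity>\<close>: all iterated partial derivatives, of any order
  (including order 0), are Frechet differentiable on \<open>S\<close>. Only used with open \<open>S\<close>.\<close>

definition smooth_on :: "'a::euclidean_space set \<Rightarrow> ('a \<Rightarrow> 'b::real_normed_vector) \<Rightarrow> bool" where
  "smooth_on S f \<longleftrightarrow> (\<forall>es \<in> lists Basis. fold dderiv es f differentiable_on S)"


section \<open>Vector fields on the space with coordinates (x, y, t, u, v)\<close>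

type_synonym point = "real \<times> real \<times> real \<times> real \<times> real"

text \<open>The field \<open>\<xi>\<^sub>x \<partial>\<^sub>x + \<xi>\<^sub>y \<partial>\<^sub>y + \<xi>\<^sub>t \<partial>\<^sub>t + \<eta>\<^sub>u \<partial>\<^sub>u + \<eta>\<^sub>v \<partial>\<^sub>v\<close> is the map with components
  \<open>(\<xi>\<^sub>x, \<xi>\<^sub>y, \<xi>\<^sub>t, \<eta>\<^sub>u, \<eta>\<^sub>v)\<close>.\<close>

type_synonym vfield = "point \<Rightarrow> point"

definition xi_x :: "vfield \<Rightarrow> point \<Rightarrow> real" where
  "xi_x Z p = (case Z p of (\<xi>x, \<xi>y, \<xi>t, \<eta>u, \<eta>v) \<Rightarrow> \<xi>x)"

definition xi_y :: "vfield \<Rightarrow> point \<Rightarrow> real" where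
  "xi_y Z p = (case Z p of (\<xi>x, \<xi>y, \<xi>t, \<eta>u, \<eta>v) \<Rightarrow> \<xi>y)"

definition xi_t :: "vfield \<Rightarrow> point \<Rightarrow> real" where
  "xi_t Z p = (case Z p of (\<xi>x, \<xi>y, \<xi>t, \<eta>u, \<eta>v) \<Rightarrow> \<xi>t)"

definition eta_u :: "vfield \<Rightarrow> point \<Rightarrow> real" where
  "eta_u Z p = (case Z p of (\<xi>x, \<xi>y, \<xi>t, \<eta>u, \<eta>v) \<Rightarrow> \<eta>u)"

definition eta_v :: "vfield \<Rightarrow> point \<Rightarrow> real" where
  "eta_v Z p = (case Z p of (\<xi>x, \<xi>y, \<xi>t, \<eta>u, \<eta>v) \<Rightarrow> \<eta>v)"

definition vf_scale :: "real \<Rightarrow> vfield \<Rightarrow> vfield" where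
  "vf_scale r Z = (\<lambda>p. r *\<^sub>R Z p)"

interpretation vf: vector_space vf_scale
  by unfold_locales (auto simp: vf_scale_def fun_eq_iff algebra_simps)

text \<open>The commutator: the \<open>i\<close>-th component is \<open>Z(W\<^sup>i) - W(Z\<^sup>i)\<close>.\<close>

definition lie_bracket :: "vfield \<Rightarrow> vfield \<Rightarrow> vfield" where
  "lie_bracket Z W =
     (\<lambda>p. frechet_derivative W (at p) (Z p) - frechet_derivative Z (at p) (W p))"

definition lie_algebra :: "vfield set \<Rightarrow> bool" where
  "lie_algebra L \<longleftrightarrow>
     vf.subspace L \<and>
     (\<forall>Z\<in>L. \<forall>W\<in>L. lie_bracket Z W \<in> L) \<and>
     (\<forall>r s. \<forall>Z\<in>L. \<forall>Z'\<in>L. \<forall>W\<in>L.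
        lie_bracket (vf_scale r Z + vf_scale s Z') W =
          vf_scale r (lie_bracket Z W) + vf_scale s (lie_bracket Z' W) \<and>
        lie_bracket W (vf_scale r Z + vf_scale s Z') =
          vf_scale r (lie_bracket W Z) + vf_scale s (lie_bracket W Z')) \<and>
     (\<forall>Z\<in>L. lie_bracket Z Z = 0) \<and>
     (\<forall>Z\<in>L. \<forall>Z'\<in>L. \<forall>W\<in>L.
        lie_bracket Z (lie_bracket Z' W) + lie_bracket Z' (lie_bracket W Z)
          + lie_bracket W (lie_bracket Z Z') = 0)"


section \<open>Jets and prolongation\<close>

datatype indep = IX | IY | IT
datatype dep = DU | DV

text \<open>The multi-index \<open>(i, k, l)\<close> stands for \<open>\<partial>\<^sub>x\<^sup>i \<partial>\<^sub>y\<^sup>k \<partial>\<^sub>t\<^sup>l\<close>.\<close>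

type_synonym midx = "nat \<times> nat \<times> nat"

fun midx_order :: "midx \<Rightarrow> nat" where
  "midx_order (i, k, l) = i + k + l"

fun bump :: "indep \<Rightarrow> midx \<Rightarrow> midx" where
  "bump IX (i, k, l) = (Suc i, k, l)"
| "bump IY (i, k, l) = (i, Suc k, l)"
| "bump IT (i, k, l) = (i, k, Suc l)"

text \<open>A jet assigns a value to each independent variable and to each derivative of \<open>u\<close> and
  \<open>v\<close>. The type carries coordinates of every order; everything below involves only those of
  order at most 4, i.e. lives on the fourth jet space.\<close>

datatype jet_coord = Indep indep | Deriv dep midx

type_synonym jet = "jet_coord \<Rightarrow> real"

definition base :: "jet \<Rightarrow> point" where
  "base j = (j (Indep IX), j (Indep IY), j (Indep IT),
             j (Deriv DU (0, 0, 0)), j (Deriv DV (0, 0, 0)))"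

definition pdiff :: "jet_coord \<Rightarrow> (jet \<Rightarrow> real) \<Rightarrow> jet \<Rightarrow> real" where
  "pdiff q F j = deriv (\<lambda>s. F (j(q := s))) (j q)"

text \<open>Total derivative of a differential function of order at most 3 (hence the bound in the sum);
  the result has order at most 4.\<close>

definition total_deriv :: "indep \<Rightarrow> (jet \<Rightarrow> real) \<Rightarrow> jet \<Rightarrow> real" where
  "total_deriv s F j = pdiff (Indep s) F j +
     (\<Sum>w\<in>{DU, DV}. \<Sum>J | midx_order J \<le> 3. j (Deriv w (bump s J)) * pdiff (Deriv w J) F j)"

fun xi_coeff :: "vfield \<Rightarrow> indep \<Rightarrow> jet \<Rightarrow> real" where
  "xi_coeff Z IX j = xi_x Z (base j)"
| "xi_coeff Z IY j = xi_y Z (base j)"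
| "xi_coeff Z IT j = xi_t Z (base j)"

fun eta_coeff :: "vfield \<Rightarrow> dep \<Rightarrow> jet \<Rightarrow> real" where
  "eta_coeff Z DU j = eta_u Z (base j)"
| "eta_coeff Z DV j = eta_v Z (base j)"

text \<open>One step of the recursive prolongation formula
  \<open>\<eta>\<^sup>J\<^sup>,\<^sup>r = D\<^sub>r \<eta>\<^sup>J - (\<Sum>s. (D\<^sub>r \<xi>\<^sub>s) w\<^sub>J\<^sub>,\<^sub>s)\<close>, where \<open>\<phi>\<close> is the coefficient \<open>\<eta>\<^sup>J\<close>
  belonging to the dependent variable \<open>w\<close>.\<close>

definition prolong_step ::
  "vfield \<Rightarrow> dep \<Rightarrow> midx \<Rightarrow> indep \<Rightarrow> (jet \<Rightarrow> real) \<Rightarrow> jet \<Rightarrow> real" where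
  "prolong_step Z w J r \<phi> = (\<lambda>j. total_deriv r \<phi> j -
     (\<Sum>s\<in>{IX, IY, IT}. total_deriv r (xi_coeff Z s) j * j (Deriv w (bump s J))))"

fun prolong_coeff :: "vfield \<Rightarrow> dep \<Rightarrow> midx \<Rightarrow> jet \<Rightarrow> real" where
  "prolong_coeff Z w (0, 0, 0) = eta_coeff Z w"
| "prolong_coeff Z w (Suc i, k, l) = prolong_step Z w (i, k, l) IX (prolong_coeff Z w (i, k, l))"
| "prolong_coeff Z w (0, Suc k, l) = prolong_step Z w (0, k, l) IY (prolong_coeff Z w (0, k, l))"
| "prolong_coeff Z w (0, 0, Suc l) = prolong_step Z w (0, 0, l) IT (prolong_coeff Z w (0, 0, l))"

definition Pr4 :: "vfield \<Rightarrow> (jet \<Rightarrow> real) \<Rightarrow> jet \<Rightarrow> real" where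
  "Pr4 Z F j =
     (\<Sum>s\<in>{IX, IY, IT}. xi_coeff Z s j * pdiff (Indep s) F j) +
     (\<Sum>w\<in>{DU, DV}. \<Sum>J | midx_order J \<le> 4. prolong_coeff Z w J j * pdiff (Deriv w J) F j)"

fun jet_of ::
  "(real \<times> real \<times> real \<Rightarrow> real) \<Rightarrow> (real \<times> real \<times> real \<Rightarrow> real) \<Rightarrow> real \<times> real \<times> real \<Rightarrow> jet"
where
  "jet_of u v (x, y, t) (Indep IX) = x"
| "jet_of u v (x, y, t) (Indep IY) = y"
| "jet_of u v (x, y, t) (Indep IT) = t"
| "jet_of u v p (Deriv w (i, k, l)) =
     ((dderiv (1, 0, 0) ^^ i) ((dderiv (0, 1, 0) ^^ k) ((dderiv (0, 0, 1) ^^ l)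
        (case w of DU \<Rightarrow> u | DV \<Rightarrow> v)))) p"


section \<open>The extended Boiti-Leon-Manna-Pempinelli system and its symmetries\<close>

definition Delta1 :: "real \<Rightarrow> real \<Rightarrow> real \<Rightarrow> jet \<Rightarrow> real" where
  "Delta1 a b c j =
     (let u = (\<lambda>i k l. j (Deriv DU (i, k, l))); v = j (Deriv DV (0, 0, 0)) in
      u 0 1 1 - a * u 1 1 0 - b * u 0 2 0 + u 3 1 0 + c * (u 0 4 0 - 6 * v * u 0 2 0)
        - 3 * (u 0 1 0 * u 2 0 0 + u 1 0 0 * u 1 1 0))"

definition Delta2 :: "jet \<Rightarrow> real" where
  "Delta2 j = j (Deriv DU (0, 2, 0)) - j (Deriv DV (1, 0, 0))"

text \<open>Solutions are local: they are defined on an arbitrary open subset of (x, y, t)-space.\<close>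

definition is_solution ::
  "real \<Rightarrow> real \<Rightarrow> real \<Rightarrow> (real \<times> real \<times> real) set \<Rightarrow>
   (real \<times> real \<times> real \<Rightarrow> real) \<Rightarrow> (real \<times> real \<times> real \<Rightarrow> real) \<Rightarrow> bool" where
  "is_solution a b c \<Omega> u v \<longleftrightarrow>
     open \<Omega> \<and> smooth_on \<Omega> u \<and> smooth_on \<Omega> v \<and>
     (\<forall>p\<in>\<Omega>. Delta1 a b c (jet_of u v p) = 0 \<and> Delta2 (jet_of u v p) = 0)"

definition infinitesimal_symmetry :: "real \<Rightarrow> real \<Rightarrow> real \<Rightarrow> vfield \<Rightarrow> bool" where
  "infinitesimal_symmetry a b c Z \<longleftrightarrow>
     smooth_on UNIV Z \<and>
     (\<forall>\<Omega> u v. is_solution a b c \<Omega> u v \<longrightarrow>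
        (\<forall>p\<in>\<Omega>. Pr4 Z (Delta1 a b c) (jet_of u v p) = 0 \<and> Pr4 Z Delta2 (jet_of u v p) = 0))"

text \<open>A general infinitesimal symmetry has \<open>\<xi>\<^sub>x = g\<^sub>1 x / 3 + F\<^sub>1(t)\<close>,
  \<open>\<xi>\<^sub>y = g\<^sub>1 y / 3 + F\<^sub>2(t)\<close> and \<open>\<eta>\<^sub>u = F\<^sub>3(t) + R\<close>, where \<open>R\<close> vanishes for
  \<open>x = u = 0\<close>. So the arbitrary functions are recovered by evaluating these coefficients at
  \<open>(0, 0, t, 0, 0)\<close>. These definitions make sense for every vector field and do not presuppose
  the general form.\<close>

definition F1 :: "vfield \<Rightarrow> real \<Rightarrow> real" where
  "F1 Z t = xi_x Z (0, 0, t, 0, 0)"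

definition F2 :: "vfield \<Rightarrow> real \<Rightarrow> real" where
  "F2 Z t = xi_y Z (0, 0, t, 0, 0)"

definition F3 :: "vfield \<Rightarrow> real \<Rightarrow> real" where
  "F3 Z t = eta_u Z (0, 0, t, 0, 0)"

definition L5 :: "real \<Rightarrow> real \<Rightarrow> real \<Rightarrow> vfield set" where
  "L5 a b c = {Z. infinitesimal_symmetry a b c Z \<and>
     F1 Z constant_on UNIV \<and> F2 Z constant_on UNIV \<and> F3 Z constant_on UNIV}"

definition v1 :: "real \<Rightarrow> real \<Rightarrow> real \<Rightarrow> vfield" where
  "v1 a b c = (\<lambda>(x, y, t, u, v).
     (x / 3, y / 3, t, (- 2 * a * x - 3 * u) / 9, (- 12 * c * v - 2 * b) / (18 * c)))"

definition v2 :: vfield where "v2 = (\<lambda>_. (0, 0, 1, 0, 0))"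
definition v3 :: vfield where "v3 = (\<lambda>_. (1, 0, 0, 0, 0))"
definition v4 :: vfield where "v4 = (\<lambda>_. (0, 1, 0, 0, 0))"
definition v5 :: vfield where "v5 = (\<lambda>_. (0, 0, 0, 1, 0))"

end

theory Submission
  imports Defs
begin

text \<open>
  Only explicit solutions are needed to find all symmetries. The polynomial solutions
  \<open>u = g(x) + \<alpha> y + \<beta> t\<close>, \<open>v = h(y) + \<gamma> t\<close> with \<open>\<alpha> g'' = 0\<close> have jets so free that the
  symmetry condition splits with respect to them. The rational solutions
  \<open>u = - 2 \<kappa> / \<zeta> + g\<^sub>1 x + \<dots>\<close>, \<open>v = 2 \<rho>\<^sup>2 / \<zeta>\<^sup>2 + h\<close> with
  \<open>\<zeta> = \<kappa> x + \<rho> y + m t + d\<close> and \<open>m = a \<kappa> + b \<rho> + 6 c h \<rho> + 3 g\<^sub>1 \<kappa>\<close> (poles of KdV type) turn the condition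
  into a Laurent polynomial in \<open>\<zeta>\<close>, whose coefficients give the relations between the scalings of
  \<open>x\<close>, \<open>y\<close>, \<open>t\<close>, \<open>u\<close> and \<open>v\<close>. The condition for \<open>u\<^sub>y\<^sub>y = v\<^sub>x\<close> is exploited first: it makes the field
  projectable and affine in \<open>u\<close>, which keeps the fourth prolongation short.
  Conversely, on jets \<open>v\<^sub>1\<close> multiplies \<open>\<Delta>\<^sub>1\<close> by \<open>- 5 / 3\<close> and \<open>\<Delta>\<^sub>2\<close> by \<open>- 1\<close>.
\<close>

section \<open>Partial derivatives of smooth maps\<close>

lemma dderiv_eqI: "(f has_derivative f') (at p) \<Longrightarrow> dderiv e f p = f' e"
  unfolding dderiv_def using frechet_derivative_at by metis

lemma dderiv_const [simp]: "dderiv e (\<lambda>_. k) = (\<lambda>_. 0)"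
  by (intro ext dderiv_eqI[where f' = "\<lambda>_. 0"] has_derivative_const)

lemma dderiv_has_vector_derivative:
  assumes "f differentiable (at (p + r *\<^sub>R e))"
  shows "((\<lambda>r. f (p + r *\<^sub>R e)) has_vector_derivative dderiv e f (p + r *\<^sub>R e)) (at r)"
proof -
  have f: "(f has_derivative frechet_derivative f (at (p + r *\<^sub>R e))) (at (p + r *\<^sub>R e))"
    using assms frechet_derivative_works by blast
  have "((\<lambda>r. p + r *\<^sub>R e) has_derivative (\<lambda>h. h *\<^sub>R e)) (at r)"
    by (auto intro!: derivative_eq_intros)
  from has_derivative_compose[OF this f]
  show ?thesis
    unfolding has_vector_derivative_def dderiv_def
    by (simp add: linear_cmul[OF linear_frechet_derivative[OF assms]])
qed

lemma dderiv_linear_compose: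
  assumes "bounded_linear L" "f differentiable (at p)"
  shows "(\<lambda>q. L (f q)) differentiable (at p)" "dderiv e (\<lambda>q. L (f q)) p = L (dderiv e f p)"
proof -
  have "(f has_derivative frechet_derivative f (at p)) (at p)"
    using assms frechet_derivative_works by blast
  from bounded_linear.has_derivative[OF assms(1) this]
  show "(\<lambda>q. L (f q)) differentiable (at p)" "dderiv e (\<lambda>q. L (f q)) p = L (dderiv e f p)"
    by (auto simp: differentiable_def dderiv_eqI) (simp add: dderiv_def)
qed

lemma smooth_on_differentiable: "smooth_on UNIV f \<Longrightarrow> f differentiable (at p)"
  unfolding smooth_on_def differentiable_on_def by (force dest: bspec[of _ _ "[]"])

lemma smooth_on_dderiv: "smooth_on S f \<Longrightarrow> e \<in> Basis \<Longrightarrow> smooth_on S (dderiv e f)"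
  unfolding smooth_on_def by (metis fold_simps(2) lists.Cons)

lemma smooth_on_linear_compose:
  assumes L: "bounded_linear L" and f: "smooth_on UNIV f"
  shows "smooth_on UNIV (\<lambda>p. L (f p))"
proof -
  have "fold dderiv es (\<lambda>p. L (f p)) differentiable_on UNIV" if "es \<in> lists Basis" for es
    using that f
  proof (induction es arbitrary: f rule: list.induct)
    case Nil
    then show ?case
      using dderiv_linear_compose(1)[OF L] smooth_on_differentiable
      by (auto simp: differentiable_on_def)
  next
    case (Cons e es)
    have "dderiv e (\<lambda>p. L (f p)) = (\<lambda>p. L (dderiv e f p))"
      using dderiv_linear_compose(2)[OF L] smooth_on_differentiable[OF Cons.prems(2)] by blast
    moreover have "smooth_on UNIV (dderiv e f)"
      using Cons.prems smooth_on_dderiv by (metis Cons_in_lists_iff)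
    ultimately show ?case
      using Cons by auto
  qed
  then show ?thesis
    unfolding smooth_on_def by blast
qed

lemma dderiv_const_imp_affine:
  fixes f :: "'a::euclidean_space \<Rightarrow> real"
  assumes f: "\<And>q. f differentiable (at q)" and c: "\<And>r. dderiv e f (p + r *\<^sub>R e) = c"
  shows "f (p + r *\<^sub>R e) = f p + r * c"
proof -
  have "((\<lambda>r. f (p + r *\<^sub>R e) - r * c) has_real_derivative 0) (at r)" for r
    using dderiv_has_vector_derivative[OF f, where p = p and r = r and e = e] c
    by (auto intro!: derivative_eq_intros simp: has_real_derivative_iff_has_vector_derivative[symmetric])
  then obtain k where "\<And>r. f (p + r *\<^sub>R e) - r * c = k"
    using DERIV_isconst_all[of "\<lambda>r. f (p + r *\<^sub>R e) - r * c"] by metis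
  from this[of r] this[of 0] show ?thesis
    by simp
qed

text \<open>Differentiate \<open>f (q + r e) = f q + r \<partial>\<^sub>e f q\<close> in direction \<open>e'\<close>, then in \<open>r\<close>.\<close>

lemma dderiv_commute_of_affine:
  fixes f :: "'a::euclidean_space \<Rightarrow> real"
  assumes f: "\<And>q. f differentiable (at q)"
    and fe: "\<And>q. dderiv e f differentiable (at q)"
    and fe': "\<And>q. dderiv e' f differentiable (at q)"
    and ee: "\<And>q. dderiv e (dderiv e f) q = 0"
  shows "dderiv e (dderiv e' f) p = dderiv e' (dderiv e f) p"
proof -
  have const: "dderiv e f (q + r *\<^sub>R e) = dderiv e f q" for q r
    using dderiv_const_imp_affine[OF fe, where e = e and p = q and c = 0] ee by simp
  have affine: "f (q + r *\<^sub>R e) = f q + r * dderiv e f q" for q r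
    using dderiv_const_imp_affine[OF f, where e = e and p = q and c = "dderiv e f q"] const by simp
  have shift: "dderiv e' f (p + r *\<^sub>R e) = dderiv e' f p + r * dderiv e' (dderiv e f) p" for r
  proof -
    have F: "(f has_derivative frechet_derivative f (at q)) (at q)"
      and FE: "(dderiv e f has_derivative frechet_derivative (dderiv e f) (at q)) (at q)" for q
      using f fe frechet_derivative_works by blast+
    have "((\<lambda>q. q + r *\<^sub>R e) has_derivative (\<lambda>h. h)) (at p)"
      by (auto intro!: derivative_eq_intros)
    from has_derivative_compose[OF this F]
    have "((\<lambda>q. f (q + r *\<^sub>R e)) has_derivative frechet_derivative f (at (p + r *\<^sub>R e))) (at p)"
      by simp
    moreover have "((\<lambda>q. f (q + r *\<^sub>R e)) has_derivative
        (\<lambda>h. frechet_derivative f (at p) h + r * frechet_derivative (dderiv e f) (at p) h)) (at p)"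
      by (simp only: affine) (rule has_derivative_add[OF F has_derivative_mult_right[OF FE]])
    ultimately have "frechet_derivative f (at (p + r *\<^sub>R e)) =
        (\<lambda>h. frechet_derivative f (at p) h + r * frechet_derivative (dderiv e f) (at p) h)"
      by (rule has_derivative_unique)
    then show ?thesis
      by (simp add: dderiv_def[of e'])
  qed
  have "((\<lambda>r. dderiv e' f (p + r *\<^sub>R e)) has_real_derivative dderiv e (dderiv e' f) p) (at 0)"
    using dderiv_has_vector_derivative[where f = "dderiv e' f" and p = p and r = 0 and e = e] fe'
    by (simp add: has_real_derivative_iff_has_vector_derivative)
  moreover have "((\<lambda>r. dderiv e' f (p + r *\<^sub>R e)) has_real_derivative dderiv e' (dderiv e f) p) (at 0)"
    unfolding shift by (auto intro!: derivative_eq_intros)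
  ultimately show ?thesis
    by (rule DERIV_unique)
qed

section \<open>Sums of ridge functions and their jets\<close>

text \<open>A ridge is a sequence of functions, the \<open>n\<close>-th of which stands for the \<open>n\<close>-th derivative of the
  first, together with a direction.\<close>

type_synonym ridge = "(nat \<Rightarrow> real \<Rightarrow> real) \<times> (real \<times> real \<times> real)"

definition ridge_sum :: "ridge list \<Rightarrow> real \<times> real \<times> real \<Rightarrow> real" where
  "ridge_sum L p = (\<Sum>(F, \<omega>)\<leftarrow>L. F 0 (\<omega> \<bullet> p))"

definition ridges_on :: "(real \<times> real \<times> real) set \<Rightarrow> ridge list \<Rightarrow> bool" where
  "ridges_on \<Omega> L \<longleftrightarrow> open \<Omega> \<and> (\<forall>(F, \<omega>) \<in> set L. \<forall>p\<in>\<Omega>. \<forall>n.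
     (F n has_real_derivative F (Suc n) (\<omega> \<bullet> p)) (at (\<omega> \<bullet> p)))"

text \<open>The weight \<open>K \<omega>\<close> is arbitrary so that the rule can be iterated:
  differentiating in direction h only multiplies it by \<omega> \<bullet> h.\<close>

lemma has_derivative_ridges:
  assumes "ridges_on \<Omega> L" "p \<in> \<Omega>"
  shows "((\<lambda>p. \<Sum>(F, \<omega>)\<leftarrow>L. K \<omega> * F n (\<omega> \<bullet> p)) has_derivative
     (\<lambda>h. \<Sum>(F, \<omega>)\<leftarrow>L. (K \<omega> * (\<omega> \<bullet> h)) * F (Suc n) (\<omega> \<bullet> p))) (at p)"
  using assms
proof (induction L)
  case Nil
  then show ?case by simp
next
  case (Cons R L)
  obtain F \<omega> where R: "R = (F, \<omega>)" by (cases R)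
  have "(F n has_derivative (\<lambda>h. h * F (Suc n) (\<omega> \<bullet> p))) (at (\<omega> \<bullet> p))"
  proof -
    have "(F n has_real_derivative F (Suc n) (\<omega> \<bullet> p)) (at (\<omega> \<bullet> p))"
      using Cons.prems by (auto simp: ridges_on_def R)
    then show ?thesis
      unfolding has_field_derivative_def by (rule has_derivative_eq_rhs) (simp add: fun_eq_iff)
  qed
  from has_derivative_compose[OF has_derivative_inner_right[OF has_derivative_ident] this]
  have "((\<lambda>p. K \<omega> * F n (\<omega> \<bullet> p)) has_derivative (\<lambda>h. (K \<omega> * (\<omega> \<bullet> h)) * F (Suc n) (\<omega> \<bullet> p))) (at p)"
    using has_derivative_mult_right by (fastforce simp: mult.assoc)
  moreover have "ridges_on \<Omega> L"
    using Cons.prems by (auto simp: ridges_on_def)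
  ultimately show ?case
    using Cons.IH Cons.prems by (auto simp: R intro!: has_derivative_add)
qed

lemma fold_dderiv_ridge_sum:
  assumes L: "ridges_on \<Omega> L" and p: "p \<in> \<Omega>"
  shows "fold dderiv es (ridge_sum L) p =
     (\<Sum>(F, \<omega>)\<leftarrow>L. (\<Prod>e\<leftarrow>es. \<omega> \<bullet> e) * F (length es) (\<omega> \<bullet> p))"
    and "fold dderiv es (ridge_sum L) differentiable (at p)"
proof -
  have op: "open \<Omega>" using L by (simp add: ridges_on_def)
  have *: "(\<forall>p\<in>\<Omega>. fold dderiv es (ridge_sum L) p =
     (\<Sum>(F, \<omega>)\<leftarrow>L. (\<Prod>e\<leftarrow>es. \<omega> \<bullet> e) * F (length es) (\<omega> \<bullet> p)))
     \<and> (\<forall>p\<in>\<Omega>. (fold dderiv es (ridge_sum L) has_derivative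
     (\<lambda>h. \<Sum>(F, \<omega>)\<leftarrow>L. ((\<Prod>e\<leftarrow>es. \<omega> \<bullet> e) * (\<omega> \<bullet> h)) * F (Suc (length es)) (\<omega> \<bullet> p))) (at p))"
  \<comment> \<open>\<open>fold\<close> applies the last direction of the list outermost, hence the
    induction from the right end.\<close>
  proof (induction es rule: rev_induct)
    case Nil
    have "ridge_sum L = (\<lambda>p. \<Sum>(F, \<omega>)\<leftarrow>L. 1 * F 0 (\<omega> \<bullet> p))"
      by (auto simp: ridge_sum_def)
    then show ?case
      using has_derivative_ridges[OF L, of _ "\<lambda>_. 1" 0] by auto
  next
    case (snoc e es)
    have 1: "fold dderiv (es @ [e]) (ridge_sum L) p =
       (\<Sum>(F, \<omega>)\<leftarrow>L. (\<Prod>e\<leftarrow>es @ [e]. \<omega> \<bullet> e) * F (length (es @ [e])) (\<omega> \<bullet> p))"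
      if "p \<in> \<Omega>" for p
      using snoc that by (auto dest: dderiv_eqI)
    \<comment> \<open>The new partial derivative agrees with a weighted ridge sum on the open set
      \<Omega> only, which is enough because derivatives are local.\<close>
    have "(fold dderiv (es @ [e]) (ridge_sum L) has_derivative
       (\<lambda>h. \<Sum>(F, \<omega>)\<leftarrow>L. ((\<Prod>e\<leftarrow>es @ [e]. \<omega> \<bullet> e) * (\<omega> \<bullet> h)) * F (Suc (length (es @ [e]))) (\<omega> \<bullet> p)))
       (at p)" if "p \<in> \<Omega>" for p
      by (rule has_derivative_transform_within_open[OF has_derivative_ridges[OF L that] op that])
        (simp only: 1)
    with 1 show ?case by blast
  qed
  then show "fold dderiv es (ridge_sum L) p =
     (\<Sum>(F, \<omega>)\<leftarrow>L. (\<Prod>e\<leftarrow>es. \<omega> \<bullet> e) * F (length es) (\<omega> \<bullet> p))"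
    and "fold dderiv es (ridge_sum L) differentiable (at p)"
    using p by (blast, auto simp: differentiable_def)
qed

lemma smooth_on_ridge_sum: "ridges_on \<Omega> L \<Longrightarrow> smooth_on \<Omega> (ridge_sum L)"
  unfolding smooth_on_def differentiable_on_def
  using fold_dderiv_ridge_sum(2) differentiable_at_withinI by blast

lemma fold_replicate_funpow: "fold f (replicate n x) = f x ^^ n"
  by (induction n) (auto simp: funpow_Suc_right simp del: funpow.simps)

text \<open>The t-directions come first in the list because \<open>fold\<close> applies its head
  first, and \<open>jet_of\<close> has the t-derivatives innermost.\<close>

lemma jet_ridge_sum:
  assumes "ridges_on \<Omega> L" "p \<in> \<Omega>"
  shows "((dderiv (1, 0, 0) ^^ i) ((dderiv (0, 1, 0) ^^ k) ((dderiv (0, 0, 1) ^^ l) (ridge_sum L)))) p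
    = (\<Sum>(F, (\<alpha>, \<beta>, \<gamma>))\<leftarrow>L. \<alpha> ^ i * \<beta> ^ k * \<gamma> ^ l * F (i + k + l) (\<alpha> * fst p + \<beta> * fst (snd p) + \<gamma> * snd (snd p)))"
  using fold_dderiv_ridge_sum(1)[OF assms, of "replicate l (0,0,1) @ replicate k (0,1,0) @ replicate i (1,0,0)"]
  by (cases p) (simp add: fold_replicate_funpow case_prod_unfold prod_list_replicate inner_prod_def ac_simps)

section \<open>Profiles of the ridges: cubic polynomials and inverse powers\<close>

text \<open>Differentiation shifts the Taylor coefficients. At 0 the value is the n-th coefficient
  itself, so derivatives of a polynomial solution can be prescribed directly.\<close>

fun cubic :: "real \<Rightarrow> real \<Rightarrow> real \<Rightarrow> real \<Rightarrow> nat \<Rightarrow> real \<Rightarrow> real" where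
  "cubic c0 c1 c2 c3 0 s = c0 + c1 * s + c2 * s\<^sup>2 / 2 + c3 * s ^ 3 / 6"
| "cubic c0 c1 c2 c3 (Suc n) s = cubic c1 c2 c3 0 n s"

lemma DERIV_cubic: "(cubic c0 c1 c2 c3 n has_real_derivative cubic c0 c1 c2 c3 (Suc n) s) (at s)"
proof (induction n arbitrary: c0 c1 c2 c3)
  case 0
  have "((\<lambda>s. c0 + c1 * s + c2 * s\<^sup>2 / 2 + c3 * s ^ 3 / 6) has_real_derivative
      c1 + c2 * s + c3 * s\<^sup>2 / 2) (at s)"
    by (auto intro!: derivative_eq_intros)
  moreover have "cubic c0 c1 c2 c3 0 = (\<lambda>s. c0 + c1 * s + c2 * s\<^sup>2 / 2 + c3 * s ^ 3 / 6)"
    by (rule ext) simp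
  ultimately show ?case by simp
next
  case (Suc n)
  then show ?case by simp
qed

text \<open>The n-th derivative of C / s ^ m, obtained by updating exponent and constant.\<close>

fun inv_power :: "nat \<Rightarrow> real \<Rightarrow> nat \<Rightarrow> real \<Rightarrow> real" where
  "inv_power m C 0 s = C / s ^ m"
| "inv_power m C (Suc n) s = inv_power (Suc m) (- real m * C) n s"

lemma DERIV_inv_power:
  "s \<noteq> 0 \<Longrightarrow> (inv_power m C n has_real_derivative inv_power m C (Suc n) s) (at s)"
proof (induction n arbitrary: m C)
  case 0
  have "((\<lambda>s. C / s ^ m) has_real_derivative - real m * C / s ^ Suc m) (at s)"
  \<comment> \<open>The exponent \<open>m - Suc 0\<close> from the power rule is a true predecessor
    only for positive m; for m = 0 the function is constant.\<close>
  proof (cases m)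
    case (Suc k)
    have "((\<lambda>s. C / s ^ m) has_real_derivative (0 * s ^ m - C * (real m * s ^ (m - Suc 0))) / (s ^ m * s ^ m)) (at s)"
      using 0 DERIV_divide[OF DERIV_const DERIV_pow] by auto
    also have "(0 * s ^ m - C * (real m * s ^ (m - Suc 0))) / (s ^ m * s ^ m) = - real m * C / s ^ Suc m"
      using 0 by (simp add: Suc field_simps)
    finally show ?thesis .
  qed simp
  moreover have "inv_power m C 0 = (\<lambda>s. C / s ^ m)"
    by (rule ext) simp
  ultimately show ?case by simp
next
  case (Suc n)
  show ?case
    using Suc.IH[OF Suc.prems, of "Suc m" "- real m * C"] by (simp only: inv_power.simps)
qed

section \<open>Total derivatives and prolongation\<close>

text \<open>The direction in which \<open>base\<close> moves when the given jet coordinate changes.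
  It is 0 for proper derivatives, which \<open>base\<close> does not see.\<close>

fun coord_dir :: "jet_coord \<Rightarrow> point" where
  "coord_dir (Indep IX) = (1, 0, 0, 0, 0)"
| "coord_dir (Indep IY) = (0, 1, 0, 0, 0)"
| "coord_dir (Indep IT) = (0, 0, 1, 0, 0)"
| "coord_dir (Deriv DU (0, 0, 0)) = (0, 0, 0, 1, 0)"
| "coord_dir (Deriv DV (0, 0, 0)) = (0, 0, 0, 0, 1)"
| "coord_dir (Deriv w J) = 0"

abbreviation "dx \<equiv> dderiv (coord_dir (Indep IX))"
abbreviation "dy \<equiv> dderiv (coord_dir (Indep IY))"
abbreviation "dt \<equiv> dderiv (coord_dir (Indep IT))"
abbreviation "du \<equiv> dderiv (coord_dir (Deriv DU (0, 0, 0)))"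
abbreviation "dv \<equiv> dderiv (coord_dir (Deriv DV (0, 0, 0)))"

abbreviation (input) "U i k l j \<equiv> j (Deriv DU (i, k, l))"
abbreviation (input) "V i k l j \<equiv> j (Deriv DV (i, k, l))"

lemma coord_dir_Deriv_eq_0: "J \<noteq> (0, 0, 0) \<Longrightarrow> coord_dir (Deriv w J) = 0"
  by (cases "(Deriv w J)" rule: coord_dir.cases) auto

lemma coord_dir_basis:
  "coord_dir (Indep r) \<in> Basis" "coord_dir (Deriv w (0, 0, 0)) \<in> Basis"
proof -
  show "coord_dir (Indep r) \<in> Basis"
    by (cases r) (auto simp: Basis_prod_def zero_prod_def)
  show "coord_dir (Deriv w (0, 0, 0)) \<in> Basis"
    by (cases w) (auto simp: Basis_prod_def zero_prod_def)
qed

lemma base_upd: "base (j(q := s)) = base j + (s - j q) *\<^sub>R coord_dir q"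
  by (cases q rule: coord_dir.cases) (auto simp: base_def)

declare coord_dir.simps [simp del]

lemma dderiv_zero: "f differentiable (at p) \<Longrightarrow> dderiv 0 f p = 0"
  by (simp add: dderiv_def linear_0[OF linear_frechet_derivative])

lemma DERIV_base:
  assumes "f differentiable (at (base j))"
  shows "((\<lambda>s. f (base (j(q := s)))) has_real_derivative dderiv (coord_dir q) f (base j)) (at (j q))"
proof -
  have "((\<lambda>r. f (base j + r *\<^sub>R coord_dir q)) has_real_derivative dderiv (coord_dir q) f (base j)) (at (j q - j q))"
    using dderiv_has_vector_derivative[of f "base j" 0 "coord_dir q"] assms
    by (simp add: has_real_derivative_iff_has_vector_derivative)
  then have "((\<lambda>r. f (base j + r *\<^sub>R coord_dir q)) \<circ> (\<lambda>s. s - j q) has_real_derivative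
      dderiv (coord_dir q) f (base j) * 1) (at (j q))"
    by (intro DERIV_chain) (auto intro!: derivative_eq_intros)
  then show ?thesis
    by (simp add: base_upd comp_def)
qed

lemma DERIV_coord: "((\<lambda>s. (j(q := s)) q') has_real_derivative (if q = q' then 1 else 0)) (at x)"
  by (cases "q = q'") auto

lemma finite_midx: "finite {J. midx_order J \<le> n}"
  by (rule finite_subset[of _ "{..n} \<times> {..n} \<times> {..n}"]) (auto elim!: midx_order.elims)

text \<open>Differentiability along each jet coordinate suffices, because \<^const>\<open>total_deriv\<close> is a sum of
  partial derivatives; no topology on the space of jets is involved.\<close>

definition has_total_deriv :: "indep \<Rightarrow> (jet \<Rightarrow> real) \<Rightarrow> real \<Rightarrow> jet \<Rightarrow> bool" where
  "has_total_deriv r F D j \<longleftrightarrow> (\<forall>q. (\<lambda>s. F (j(q := s))) field_differentiable (at (j q))) \<and> total_deriv r F j = D"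

lemma pdiffI: "((\<lambda>s. F (j(q := s))) has_real_derivative D) (at (j q)) \<Longrightarrow> pdiff q F j = D"
  unfolding pdiff_def by (rule DERIV_imp_deriv)

lemma pdiff_DERIV:
  "(\<lambda>s. F (j(q := s))) field_differentiable (at (j q)) \<Longrightarrow>
    ((\<lambda>s. F (j(q := s))) has_real_derivative pdiff q F j) (at (j q))"
  unfolding pdiff_def by (simp add: field_differentiable_derivI)

lemma has_total_deriv_const: "has_total_deriv r (\<lambda>_. C) 0 j"
  by (simp add: has_total_deriv_def total_deriv_def pdiff_def)

lemma has_total_deriv_add:
  assumes "has_total_deriv r F F' j" "has_total_deriv r G G' j"
  shows "has_total_deriv r (\<lambda>j. F j + G j) (F' + G') j"
proof -
  have F: "(\<lambda>s. F (j(q := s))) field_differentiable (at (j q))"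
    and G: "(\<lambda>s. G (j(q := s))) field_differentiable (at (j q))" for q
    using assms by (auto simp only: has_total_deriv_def)
  have D: "F' = total_deriv r F j" "G' = total_deriv r G j"
    using assms by (auto simp only: has_total_deriv_def)
  have p: "pdiff q (\<lambda>j. F j + G j) j = pdiff q F j + pdiff q G j" for q
    by (intro pdiffI DERIV_add pdiff_DERIV F G)
  show ?thesis
    unfolding has_total_deriv_def
  proof (intro conjI allI)
    show "(\<lambda>s. F (j(q := s)) + G (j(q := s))) field_differentiable (at (j q))" for q
      using F G by (rule field_differentiable_add)
  qed (simp add: D total_deriv_def p sum.distrib sum_distrib_left
      sum_distrib_right algebra_simps)
qed

lemma has_total_deriv_diff:
  assumes "has_total_deriv r F F' j" "has_total_deriv r G G' j"
  shows "has_total_deriv r (\<lambda>j. F j - G j) (F' - G') j"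
proof -
  have F: "(\<lambda>s. F (j(q := s))) field_differentiable (at (j q))"
    and G: "(\<lambda>s. G (j(q := s))) field_differentiable (at (j q))" for q
    using assms by (auto simp only: has_total_deriv_def)
  have D: "F' = total_deriv r F j" "G' = total_deriv r G j"
    using assms by (auto simp only: has_total_deriv_def)
  have p: "pdiff q (\<lambda>j. F j - G j) j = pdiff q F j - pdiff q G j" for q
    by (intro pdiffI DERIV_diff pdiff_DERIV F G)
  show ?thesis
    unfolding has_total_deriv_def
  proof (intro conjI allI)
    show "(\<lambda>s. F (j(q := s)) - G (j(q := s))) field_differentiable (at (j q))" for q
      using F G by (rule field_differentiable_diff)
  qed (simp add: D total_deriv_def p sum_subtractf sum_distrib_left
      sum_distrib_right algebra_simps)
qed

lemma has_total_deriv_mult: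
  assumes "has_total_deriv r F F' j" "has_total_deriv r G G' j"
  shows "has_total_deriv r (\<lambda>j. F j * G j) (F' * G j + F j * G') j"
proof -
  have F: "(\<lambda>s. F (j(q := s))) field_differentiable (at (j q))"
    and G: "(\<lambda>s. G (j(q := s))) field_differentiable (at (j q))" for q
    using assms by (auto simp only: has_total_deriv_def)
  have D: "F' = total_deriv r F j" "G' = total_deriv r G j"
    using assms by (auto simp only: has_total_deriv_def)
  have p: "pdiff q (\<lambda>j. F j * G j) j = pdiff q F j * G j + F j * pdiff q G j" for q
    by (intro pdiffI DERIV_cong[OF DERIV_mult[OF pdiff_DERIV[OF F] pdiff_DERIV[OF G]]]) simp
  show ?thesis
    unfolding has_total_deriv_def
  proof (intro conjI allI)
    show "(\<lambda>s. F (j(q := s)) * G (j(q := s))) field_differentiable (at (j q))" for q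
      using F G by (rule field_differentiable_mult)
  qed (simp add: D total_deriv_def p sum.distrib sum_distrib_left
      sum_distrib_right algebra_simps)
qed

text \<open>The bound is that of the truncated sum in \<open>total_deriv\<close>, in which a
  coordinate of order 4 would contribute nothing.\<close>

lemma has_total_deriv_coord:
  assumes "midx_order J \<le> 3"
  shows "has_total_deriv r (\<lambda>j. j (Deriv w J)) (j (Deriv w (bump r J))) j"
proof -
  have p: "pdiff q (\<lambda>j. j (Deriv w J)) j = (if q = Deriv w J then 1 else 0)" for q
    by (intro pdiffI DERIV_coord)
  have "total_deriv r (\<lambda>j. j (Deriv w J)) j =
     (\<Sum>w'\<in>{DU, DV}. \<Sum>J'\<in>{J. midx_order J \<le> 3}.
        if J' = J then (if w' = w then j (Deriv w (bump r J)) else 0) else 0)"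
    unfolding total_deriv_def p by (auto intro!: sum.cong)
  also have "\<dots> = j (Deriv w (bump r J))"
    using assms by (cases w) (simp_all add: sum.delta[OF finite_midx])
  finally have "total_deriv r (\<lambda>j. j (Deriv w J)) j = j (Deriv w (bump r J))" .
  moreover have "(\<lambda>s. (j(q := s)) (Deriv w J)) field_differentiable (at (j q))" for q
    unfolding field_differentiable_def using DERIV_coord[of j q "Deriv w J" "j q"] by blast
  ultimately show ?thesis
    unfolding has_total_deriv_def by blast
qed

definition base_total_deriv :: "indep \<Rightarrow> (point \<Rightarrow> real) \<Rightarrow> jet \<Rightarrow> real" where
  "base_total_deriv r f j = dderiv (coord_dir (Indep r)) f (base j) + j (Deriv DU (bump r (0, 0, 0))) * du f (base j)
     + j (Deriv DV (bump r (0, 0, 0))) * dv f (base j)"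

lemma has_total_deriv_base:
  assumes f: "smooth_on UNIV f"
  shows "has_total_deriv r (\<lambda>j. f (base j)) (base_total_deriv r f j) j"
proof -
  note df = smooth_on_differentiable[OF f]
  have p: "pdiff q (\<lambda>j. f (base j)) j = dderiv (coord_dir q) f (base j)" for q
    by (intro pdiffI DERIV_base df)
  have z: "dderiv (coord_dir (Deriv w J)) f (base j) = (if J = (0, 0, 0) then dderiv (coord_dir (Deriv w (0, 0, 0))) f (base j) else 0)" for w J
    using coord_dir_Deriv_eq_0 dderiv_zero[OF df] by simp
  have "(\<Sum>J\<in>{J. midx_order J \<le> 3}. j (Deriv w (bump r J)) * dderiv (coord_dir (Deriv w J)) f (base j))
     = (\<Sum>J\<in>{J. midx_order J \<le> 3}. if J = (0, 0, 0) then j (Deriv w (bump r (0, 0, 0))) * dderiv (coord_dir (Deriv w (0, 0, 0))) f (base j) else 0)" for w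
    by (intro sum.cong refl, subst z) simp
  then have "total_deriv r (\<lambda>j. f (base j)) j = base_total_deriv r f j"
    by (simp add: total_deriv_def p base_total_deriv_def sum.delta[OF finite_midx])
  then show ?thesis
    unfolding has_total_deriv_def field_differentiable_def using DERIV_base[OF df] by auto
qed

lemma smooth_on_coord_dir:
  assumes "smooth_on UNIV f"
  shows "smooth_on UNIV (dderiv (coord_dir (Indep r)) f)" "smooth_on UNIV (dderiv (coord_dir (Deriv w (0, 0, 0))) f)"
  using assms coord_dir_basis by (auto intro: smooth_on_dderiv)

text \<open>Second total derivatives enter the u_yy-coefficient of the prolongation, which is needed
  before anything is known about the field. Mixed partials are kept in the order in which they
  arise.\<close>

lemma has_total_deriv_base_total_deriv:
  assumes "smooth_on UNIV f"
  shows "has_total_deriv r (base_total_deriv s f) (base_total_deriv r (dderiv (coord_dir (Indep s)) f) j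
    + (j (Deriv DU (bump r (bump s (0, 0, 0)))) * du f (base j) + j (Deriv DU (bump s (0, 0, 0))) * base_total_deriv r (du f) j)
    + (j (Deriv DV (bump r (bump s (0, 0, 0)))) * dv f (base j) + j (Deriv DV (bump s (0, 0, 0))) * base_total_deriv r (dv f) j)) j"
  unfolding base_total_deriv_def[of s, abs_def]
  by (intro has_total_deriv_add has_total_deriv_mult has_total_deriv_base has_total_deriv_coord smooth_on_coord_dir assms; cases s; simp)

lemma smooth_on_components:
  assumes "smooth_on UNIV Z"
  shows "smooth_on UNIV (xi_x Z)" "smooth_on UNIV (xi_y Z)" "smooth_on UNIV (xi_t Z)"
    "smooth_on UNIV (eta_u Z)" "smooth_on UNIV (eta_v Z)"
proof -
  have *: "xi_x Z = (\<lambda>p. fst (Z p))" "xi_y Z = (\<lambda>p. fst (snd (Z p)))" "xi_t Z = (\<lambda>p. fst (snd (snd (Z p))))"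
    "eta_u Z = (\<lambda>p. fst (snd (snd (snd (Z p)))))" "eta_v Z = (\<lambda>p. snd (snd (snd (snd (Z p)))))"
    by (auto simp: xi_x_def xi_y_def xi_t_def eta_u_def eta_v_def case_prod_unfold)
  show "smooth_on UNIV (xi_x Z)" "smooth_on UNIV (xi_y Z)" "smooth_on UNIV (xi_t Z)"
    "smooth_on UNIV (eta_u Z)" "smooth_on UNIV (eta_v Z)"
    unfolding * by (rule smooth_on_linear_compose[OF _ assms],
        (intro bounded_linear_fst bounded_linear_snd bounded_linear_compose[of fst, OF bounded_linear_fst]
          bounded_linear_compose[of snd, OF bounded_linear_snd])[1])+
qed

lemma prolong_step_eq:
  assumes Z: "smooth_on UNIV Z" and \<phi>: "has_total_deriv r \<phi> \<phi>' j"
  shows "prolong_step Z w J r \<phi> j = \<phi>' - (base_total_deriv r (xi_x Z) j * j (Deriv w (bump IX J))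
    + base_total_deriv r (xi_y Z) j * j (Deriv w (bump IY J)) + base_total_deriv r (xi_t Z) j * j (Deriv w (bump IT J)))"
proof -
  have "xi_coeff Z IX = (\<lambda>j. xi_x Z (base j))" "xi_coeff Z IY = (\<lambda>j. xi_y Z (base j))"
    "xi_coeff Z IT = (\<lambda>j. xi_t Z (base j))"
    by auto
  then have "total_deriv r (xi_coeff Z IX) j = base_total_deriv r (xi_x Z) j"
    "total_deriv r (xi_coeff Z IY) j = base_total_deriv r (xi_y Z) j"
    "total_deriv r (xi_coeff Z IT) j = base_total_deriv r (xi_t Z) j"
    using smooth_on_components[OF Z, THEN has_total_deriv_base, of r j] by (simp_all add: has_total_deriv_def)
  then show ?thesis
    using \<phi> by (simp add: prolong_step_def has_total_deriv_def)
qed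

text \<open>Shaped for computing: resolving the second premise with the rules for
  \<open>has_total_deriv\<close> instantiates \<open>\<phi>'\<close>, and the third then asks for
  the closed form R.\<close>

lemma prolong_stepI:
  assumes "smooth_on UNIV Z" "has_total_deriv r \<phi> \<phi>' j"
    and "\<phi>' - (base_total_deriv r (xi_x Z) j * j (Deriv w (bump IX J))
      + base_total_deriv r (xi_y Z) j * j (Deriv w (bump IY J)) + base_total_deriv r (xi_t Z) j * j (Deriv w (bump IT J))) = R"
  shows "prolong_step Z w J r \<phi> j = R"
  using prolong_step_eq[OF assms(1,2)] assms(3) by simp

lemma prolong_coeff_zero:
  "prolong_coeff Z DU (0, 0, 0) = (\<lambda>j. eta_u Z (base j))"
  "prolong_coeff Z DV (0, 0, 0) = (\<lambda>j. eta_v Z (base j))"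
  by auto

section \<open>The prolonged field applied to the two equations\<close>

lemma pdiff_Delta1:
  "pdiff q (Delta1 a b c) j =
     (let d = (\<lambda>q'. if q = q' then 1 else 0); \<delta> = (\<lambda>i k l. d (Deriv DU (i, k, l))) in
      \<delta> 0 1 1 - a * \<delta> 1 1 0 - b * \<delta> 0 2 0 + \<delta> 3 1 0
        + c * (\<delta> 0 4 0 - 6 * (V 0 0 0 j * \<delta> 0 2 0 + d (Deriv DV (0, 0, 0)) * U 0 2 0 j))
        - 3 * (U 0 1 0 j * \<delta> 2 0 0 + \<delta> 0 1 0 * U 2 0 0 j + U 1 0 0 j * \<delta> 1 1 0 + \<delta> 1 0 0 * U 1 1 0 j))"
proof -
  define d where "d q' = (if q = q' then 1 else 0 :: real)" for q'
  have "((\<lambda>s. (j(q := s)) q') has_real_derivative d q') (at x)" for q' x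
    unfolding d_def by (rule DERIV_coord)
  then show ?thesis
    unfolding Delta1_def Let_def d_def[symmetric]
    by (intro pdiffI)
      (auto intro!: derivative_eq_intros simp del: fun_upd_apply simp: algebra_simps)
qed

lemma pdiff_Delta2:
  "pdiff q Delta2 j = (if q = Deriv DU (0, 2, 0) then 1 else 0) - (if q = Deriv DV (1, 0, 0) then 1 else 0)"
  unfolding Delta2_def
  by (intro pdiffI DERIV_diff DERIV_coord)

text \<open>The equation does not involve x, y, t explicitly, and only the multi-indices occurring
  in it have a nonzero partial derivative. What remains is its linearization at the prolonged
  coefficients.\<close>

lemma Pr4_Delta1:
  "Pr4 Z (Delta1 a b c) j =
     (let N = (\<lambda>i k l. prolong_coeff Z DU (i, k, l) j) in
      N 0 1 1 - a * N 1 1 0 - b * N 0 2 0 + N 3 1 0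
        + c * (N 0 4 0 - 6 * (V 0 0 0 j * N 0 2 0 + eta_v Z (base j) * U 0 2 0 j))
        - 3 * (U 0 1 0 j * N 2 0 0 + N 0 1 0 * U 2 0 0 j + U 1 0 0 j * N 1 1 0 + N 1 0 0 * U 1 1 0 j))"
proof -
  have 1: "(\<Sum>J\<in>{J. midx_order J \<le> 4}. prolong_coeff Z DU J j * pdiff (Deriv DU J) (Delta1 a b c) j)
     = (\<Sum>J\<in>{(0,1,1),(1,1,0),(0,2,0),(3,1,0),(0,4,0),(2,0,0),(0,1,0),(1,0,0)}.
          prolong_coeff Z DU J j * pdiff (Deriv DU J) (Delta1 a b c) j)"
    by (intro sum.mono_neutral_right finite_midx) (auto simp: pdiff_Delta1)
  have 2: "(\<Sum>J\<in>{J. midx_order J \<le> 4}. prolong_coeff Z DV J j * pdiff (Deriv DV J) (Delta1 a b c) j)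
     = (\<Sum>J\<in>{(0,0,0)}. prolong_coeff Z DV J j * pdiff (Deriv DV J) (Delta1 a b c) j)"
    by (intro sum.mono_neutral_right finite_midx) (auto simp: pdiff_Delta1)
  show ?thesis
    unfolding Pr4_def
    by (simp add: 1 2 del: prolong_coeff.simps) (simp add: pdiff_Delta1 prolong_coeff_zero algebra_simps del: prolong_coeff.simps)
qed

lemma Pr4_Delta2:
  "Pr4 Z Delta2 j = prolong_coeff Z DU (0, 2, 0) j - prolong_coeff Z DV (1, 0, 0) j"
proof -
  have 1: "(\<Sum>J\<in>{J. midx_order J \<le> 4}. prolong_coeff Z DU J j * pdiff (Deriv DU J) Delta2 j)
     = (\<Sum>J\<in>{(0,2,0)}. prolong_coeff Z DU J j * pdiff (Deriv DU J) Delta2 j)"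
    by (intro sum.mono_neutral_right finite_midx) (auto simp: pdiff_Delta2)
  have 2: "(\<Sum>J\<in>{J. midx_order J \<le> 4}. prolong_coeff Z DV J j * pdiff (Deriv DV J) Delta2 j)
     = (\<Sum>J\<in>{(1,0,0)}. prolong_coeff Z DV J j * pdiff (Deriv DV J) Delta2 j)"
    by (intro sum.mono_neutral_right finite_midx) (auto simp: pdiff_Delta2)
  show ?thesis
    unfolding Pr4_def
    by (simp add: 1 2 del: prolong_coeff.simps) (simp add: pdiff_Delta2 algebra_simps del: prolong_coeff.simps)
qed

text \<open>\<open>DD f\<close> is the second total y-derivative of f. The coefficients of Z may
  depend on all five coordinates, since this formula serves to restrict that dependence.\<close>

lemma Pr4_Delta2_eq:
  assumes Z: "smooth_on UNIV Z"
  defines "DD f j \<equiv> base_total_deriv IY (dy f) j + U 0 2 0 j * du f (base j) + U 0 1 0 j * base_total_deriv IY (du f) j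
    + V 0 2 0 j * dv f (base j) + V 0 1 0 j * base_total_deriv IY (dv f) j"
  shows "Pr4 Z Delta2 j = DD (eta_u Z) j - U 1 0 0 j * DD (xi_x Z) j - U 0 1 0 j * DD (xi_y Z) j
     - U 0 0 1 j * DD (xi_t Z) j
     - 2 * (U 1 1 0 j * base_total_deriv IY (xi_x Z) j + U 0 2 0 j * base_total_deriv IY (xi_y Z) j + U 0 1 1 j * base_total_deriv IY (xi_t Z) j)
     - base_total_deriv IX (eta_v Z) j + V 1 0 0 j * base_total_deriv IX (xi_x Z) j + V 0 1 0 j * base_total_deriv IX (xi_y Z) j
     + V 0 0 1 j * base_total_deriv IX (xi_t Z) j"
proof -
  note c = smooth_on_components[OF Z]
  have p1: "prolong_coeff Z DU (0, Suc 0, 0) = (\<lambda>j. base_total_deriv IY (eta_u Z) j - (base_total_deriv IY (xi_x Z) j * U 1 0 0 j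
      + base_total_deriv IY (xi_y Z) j * U 0 1 0 j + base_total_deriv IY (xi_t Z) j * U 0 0 1 j))"
    unfolding prolong_coeff.simps(3) prolong_coeff_zero
    by (rule ext, rule prolong_stepI[OF Z has_total_deriv_base[OF c(4)]]) simp
  have p2: "prolong_coeff Z DU (0, 2, 0) j = DD (eta_u Z) j - U 1 0 0 j * DD (xi_x Z) j - U 0 1 0 j * DD (xi_y Z) j
     - U 0 0 1 j * DD (xi_t Z) j
     - 2 * (U 1 1 0 j * base_total_deriv IY (xi_x Z) j + U 0 2 0 j * base_total_deriv IY (xi_y Z) j + U 0 1 1 j * base_total_deriv IY (xi_t Z) j)"
    unfolding numeral_2_eq_2 prolong_coeff.simps(3)[of _ _ "Suc 0"] p1
    by (rule prolong_stepI[OF Z], ((rule has_total_deriv_diff has_total_deriv_add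
        has_total_deriv_mult has_total_deriv_base_total_deriv has_total_deriv_coord c | (simp; fail))+)[1])
      (simp add: DD_def numeral_2_eq_2 algebra_simps)
  have p3: "prolong_coeff Z DV (1, 0, 0) j = base_total_deriv IX (eta_v Z) j - (base_total_deriv IX (xi_x Z) j * V 1 0 0 j
      + base_total_deriv IX (xi_y Z) j * V 0 1 0 j + base_total_deriv IX (xi_t Z) j * V 0 0 1 j)"
    unfolding One_nat_def prolong_coeff.simps(2) prolong_coeff_zero
    by (rule prolong_stepI[OF Z has_total_deriv_base[OF c(5)]]) simp
  show ?thesis
    unfolding Pr4_Delta2 p2 p3 by simp
qed

section \<open>Explicit solutions\<close>

lemma jet_of_ridge_sum:
  assumes "ridges_on \<Omega> L" "ridges_on \<Omega> M" "p \<in> \<Omega>"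
  shows "jet_of (ridge_sum L) (ridge_sum M) p (Deriv DU (i, k, l)) =
      (\<Sum>(F, (\<alpha>, \<beta>, \<gamma>))\<leftarrow>L. \<alpha> ^ i * \<beta> ^ k * \<gamma> ^ l * F (i + k + l) (\<alpha> * fst p + \<beta> * fst (snd p) + \<gamma> * snd (snd p)))"
    and "jet_of (ridge_sum L) (ridge_sum M) p (Deriv DV (i, k, l)) =
      (\<Sum>(F, (\<alpha>, \<beta>, \<gamma>))\<leftarrow>M. \<alpha> ^ i * \<beta> ^ k * \<gamma> ^ l * F (i + k + l) (\<alpha> * fst p + \<beta> * fst (snd p) + \<gamma> * snd (snd p)))"
  using assms jet_ridge_sum[of \<Omega> _ p i k l] by (cases p; simp add: jet_of.simps)+

lemma base_jet_of:
  "base (jet_of u v (x, y, t)) = (x, y, t, u (x, y, t), v (x, y, t))"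
  by (simp add: base_def jet_of.simps)

declare jet_of.simps [simp del]

text \<open>The symmetry condition sees a solution only through its jet at one point, so explicit
  solutions can be forgotten once their jets are known.\<close>

definition solution_jet :: "real \<Rightarrow> real \<Rightarrow> real \<Rightarrow> jet \<Rightarrow> bool" where
  "solution_jet a b c j \<longleftrightarrow> (\<exists>\<Omega> u v p. is_solution a b c \<Omega> u v \<and> p \<in> \<Omega> \<and> j = jet_of u v p)"

lemma DERIV_cubic_shift:
  "((\<lambda>s. cubic c0 c1 c2 c3 n (s - d)) has_real_derivative cubic c0 c1 c2 c3 (Suc n) (s - d)) (at s)"
  using DERIV_cubic[of c0 c1 c2 c3 n "s - d"] DERIV_shift[of "cubic c0 c1 c2 c3 n" "cubic c0 c1 c2 c3 (Suc n) (s - d)" s "- d"]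
  by (simp del: cubic.simps)

lemma DERIV_inv_power_shift:
  "s + d \<noteq> 0 \<Longrightarrow> ((\<lambda>s. inv_power m C n (s + d)) has_real_derivative inv_power m C (Suc n) (s + d)) (at s)"
  using DERIV_shift DERIV_inv_power by blast

text \<open>With u a sum of functions of x, y and t separately and v independent of x, both sides of
  u_yy = v_x vanish, and the first equation reduces to u_y u_xx = 0. The hypotheses give this at
  every point.\<close>

lemma polynomial_solution:
  fixes a b c :: real
  assumes "uy * uxx = 0" "uy * uxxx = 0"
  obtains j where "solution_jet a b c j"
    "base j = (x, y, t, u0, v0)"
    "\<And>i k l. j (Deriv DU (i, k, l)) =
       (if k = 0 \<and> l = 0 then cubic u0 ux uxx uxxx i 0 else 0)
       + (if i = 0 \<and> l = 0 then cubic 0 uy 0 0 k 0 else 0)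
       + (if i = 0 \<and> k = 0 then cubic 0 ut 0 0 l 0 else 0)"
    "\<And>i k l. j (Deriv DV (i, k, l)) =
       (if i = 0 \<and> l = 0 then cubic v0 vy vyy 0 k 0 else 0)
       + (if i = 0 \<and> k = 0 then cubic 0 vt 0 0 l 0 else 0)"
proof -
  define L :: "ridge list" where "L = [(\<lambda>n s. cubic u0 ux uxx uxxx n (s - x), (1, 0, 0)),
    (\<lambda>n s. cubic 0 uy 0 0 n (s - y), (0, 1, 0)), (\<lambda>n s. cubic 0 ut 0 0 n (s - t), (0, 0, 1))]"
  define M :: "ridge list" where "M = [(\<lambda>n s. cubic v0 vy vyy 0 n (s - y), (0, 1, 0)),
    (\<lambda>n s. cubic 0 vt 0 0 n (s - t), (0, 0, 1))]"
  have L: "ridges_on UNIV L" and M: "ridges_on UNIV M"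
    unfolding L_def M_def ridges_on_def using DERIV_cubic_shift by (auto simp del: cubic.simps)
  note j = jet_of_ridge_sum[OF L M UNIV_I]
  have "uy = 0 \<or> uxx = 0 \<and> uxxx = 0"
    using assms by auto
  then have eq: "Delta1 a b c (jet_of (ridge_sum L) (ridge_sum M) p) = 0"
    "Delta2 (jet_of (ridge_sum L) (ridge_sum M) p) = 0" for p
    unfolding Delta1_def Delta2_def Let_def j
    by (elim disjE conjE; simp add: L_def M_def eval_nat_numeral)+
  show ?thesis
  proof
    show "solution_jet a b c (jet_of (ridge_sum L) (ridge_sum M) (x, y, t))"
      unfolding solution_jet_def is_solution_def
      using smooth_on_ridge_sum[OF L] smooth_on_ridge_sum[OF M] eq open_UNIV UNIV_I by metis
    show "base (jet_of (ridge_sum L) (ridge_sum M) (x, y, t)) = (x, y, t, u0, v0)"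
      by (simp add: base_jet_of ridge_sum_def L_def M_def)
    show "jet_of (ridge_sum L) (ridge_sum M) (x, y, t) (Deriv DU (i, k, l)) =
       (if k = 0 \<and> l = 0 then cubic u0 ux uxx uxxx i 0 else 0)
       + (if i = 0 \<and> l = 0 then cubic 0 uy 0 0 k 0 else 0)
       + (if i = 0 \<and> k = 0 then cubic 0 ut 0 0 l 0 else 0)" for i k l
      unfolding j by (simp add: L_def power_0_left)
    show "jet_of (ridge_sum L) (ridge_sum M) (x, y, t) (Deriv DV (i, k, l)) =
       (if i = 0 \<and> l = 0 then cubic v0 vy vyy 0 k 0 else 0)
       + (if i = 0 \<and> k = 0 then cubic 0 vt 0 0 l 0 else 0)" for i k l
      unfolding j by (simp add: M_def power_0_left)
  qed
qed

text \<open>The poles of order five cancel identically, those of order three by the choice of m, a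
  dispersion relation. The difference \<open>v0 - 2 * \<rho>\<^sup>2 / z\<^sup>2\<close> is the
  constant background of v, so that \<open>v0\<close> and \<open>u0\<close> are the values at the
  base point.\<close>

lemma rational_solution:
  fixes a b c :: real
  assumes z: "z \<noteq> 0"
    and m: "m = a * \<kappa> + b * \<rho> + 6 * c * (v0 - 2 * \<rho>\<^sup>2 / z\<^sup>2) * \<rho> + 3 * g1 * \<kappa>"
  obtains j where "solution_jet a b c j"
    "base j = (x, y, t, u0, v0)"
    "\<And>i k l. j (Deriv DU (i, k, l)) =
       \<kappa> ^ i * \<rho> ^ k * m ^ l * inv_power 1 (- 2 * \<kappa>) (i + k + l) z
       + (if k = 0 \<and> l = 0 then cubic (u0 + 2 * \<kappa> / z) g1 0 0 i 0 else 0)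
       + (if i = 0 \<and> k = 0 then cubic 0 g2 0 0 l 0 else 0)"
    "\<And>i k l. j (Deriv DV (i, k, l)) =
       \<kappa> ^ i * \<rho> ^ k * m ^ l * inv_power 2 (2 * \<rho>\<^sup>2) (i + k + l) z
       + (if i = 0 \<and> k = 0 then cubic (v0 - 2 * \<rho>\<^sup>2 / z\<^sup>2) 0 0 0 l 0 else 0)"
proof -
  \<comment> \<open>This phase gives the pole variable the prescribed value z at (x, y, t).\<close>
  define d where "d = z - (\<kappa> * x + \<rho> * y + m * t)"
  define \<Omega> where "\<Omega> = {p. (\<kappa>, \<rho>, m) \<bullet> p + d \<noteq> 0}"
  define L :: "ridge list" where "L = [(\<lambda>n s. inv_power 1 (- 2 * \<kappa>) n (s + d), (\<kappa>, \<rho>, m)),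
    (\<lambda>n s. cubic (u0 + 2 * \<kappa> / z) g1 0 0 n (s - x), (1, 0, 0)),
    (\<lambda>n s. cubic 0 g2 0 0 n (s - t), (0, 0, 1))]"
  define M :: "ridge list" where "M = [(\<lambda>n s. inv_power 2 (2 * \<rho>\<^sup>2) n (s + d), (\<kappa>, \<rho>, m)),
    (\<lambda>n s. cubic (v0 - 2 * \<rho>\<^sup>2 / z\<^sup>2) 0 0 0 n (s - t), (0, 0, 1))]"
  have "open \<Omega>"
    unfolding \<Omega>_def by (intro open_Collect_neq continuous_intros)
  then have L: "ridges_on \<Omega> L" and M: "ridges_on \<Omega> M"
    unfolding L_def M_def ridges_on_def using DERIV_cubic_shift DERIV_inv_power_shift
    by (auto simp: \<Omega>_def simp del: cubic.simps inv_power.simps)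
  note j = jet_of_ridge_sum[OF L M]
  have eq: "Delta1 a b c (jet_of (ridge_sum L) (ridge_sum M) p) = 0"
    "Delta2 (jet_of (ridge_sum L) (ridge_sum M) p) = 0" if "p \<in> \<Omega>" for p
  proof -
    obtain x' y' t' where p: "p = (x', y', t')" by (cases p)
    define s where "s = \<kappa> * x' + \<rho> * y' + m * t' + d"
    have "s \<noteq> 0"
      using that by (simp add: \<Omega>_def s_def p)
    then show "Delta1 a b c (jet_of (ridge_sum L) (ridge_sum M) p) = 0"
      unfolding Delta1_def Let_def j[OF that]
      by (simp add: L_def M_def p s_def[symmetric] eval_nat_numeral) (simp add: m field_simps power2_eq_square)
    show "Delta2 (jet_of (ridge_sum L) (ridge_sum M) p) = 0"
      using \<open>s \<noteq> 0\<close> unfolding Delta2_def j[OF that]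
      by (simp add: L_def M_def p s_def[symmetric] eval_nat_numeral)
  qed
  have p: "(x, y, t) \<in> \<Omega>" and s: "\<kappa> * x + \<rho> * y + m * t + d = z" "\<kappa> * x + (\<rho> * y + m * t) + d = z"
    using z by (auto simp: \<Omega>_def d_def)
  show ?thesis
  proof
    show "solution_jet a b c (jet_of (ridge_sum L) (ridge_sum M) (x, y, t))"
      unfolding solution_jet_def is_solution_def
      using smooth_on_ridge_sum[OF L] smooth_on_ridge_sum[OF M] eq \<open>open \<Omega>\<close> p by metis
    show "base (jet_of (ridge_sum L) (ridge_sum M) (x, y, t)) = (x, y, t, u0, v0)"
      by (simp add: s base_jet_of ridge_sum_def L_def M_def)
    show "jet_of (ridge_sum L) (ridge_sum M) (x, y, t) (Deriv DU (i, k, l)) =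
       \<kappa> ^ i * \<rho> ^ k * m ^ l * inv_power 1 (- 2 * \<kappa>) (i + k + l) z
       + (if k = 0 \<and> l = 0 then cubic (u0 + 2 * \<kappa> / z) g1 0 0 i 0 else 0)
       + (if i = 0 \<and> k = 0 then cubic 0 g2 0 0 l 0 else 0)" for i k l
      unfolding j[OF p] by (simp add: L_def power_0_left s)
    show "jet_of (ridge_sum L) (ridge_sum M) (x, y, t) (Deriv DV (i, k, l)) =
       \<kappa> ^ i * \<rho> ^ k * m ^ l * inv_power 2 (2 * \<rho>\<^sup>2) (i + k + l) z
       + (if i = 0 \<and> k = 0 then cubic (v0 - 2 * \<rho>\<^sup>2 / z\<^sup>2) 0 0 0 l 0 else 0)" for i k l
      unfolding j[OF p] by (simp add: M_def power_0_left s)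
  qed
qed

section \<open>Determining equations\<close>

locale vector_field =
  fixes Z :: vfield
begin

abbreviation "X \<equiv> xi_x Z"
abbreviation "Y \<equiv> xi_y Z"
abbreviation "T \<equiv> xi_t Z"
abbreviation "A \<equiv> eta_u Z"
abbreviation "B \<equiv> eta_v Z"

end

locale blmp_symmetry = vector_field Z for Z +
  fixes a b c :: real
  assumes c: "c \<noteq> 0" and sym: "infinitesimal_symmetry a b c Z"
begin

lemma smooth_Z: "smooth_on UNIV Z"
  using sym by (simp add: infinitesimal_symmetry_def)

lemmas smooth = smooth_on_components[OF smooth_Z]

lemma Pr4_eq_0:
  assumes "solution_jet a b c j"
  shows "Pr4 Z (Delta1 a b c) j = 0" "Pr4 Z Delta2 j = 0"
  using sym assms by (auto simp: infinitesimal_symmetry_def solution_jet_def)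

text \<open>At a fixed p this is a polynomial identity in the free derivatives uy, vy, vyy, ux, ut,
  vt, so it splits into its coefficients. Taking uxx = uxxx = 0 leaves uy unrestricted.\<close>

lemma Delta2_polynomial:
  "dy (dy A) p + uy * du (dy A) p + vy * dv (dy A) p + vyy * dv A p
    + uy * (dy (du A) p + uy * du (du A) p + vy * dv (du A) p)
    + vy * (dy (dv A) p + uy * du (dv A) p + vy * dv (dv A) p)
    - ux * (dy (dy X) p + uy * du (dy X) p + vy * dv (dy X) p + vyy * dv X p
      + uy * (dy (du X) p + uy * du (du X) p + vy * dv (du X) p)
      + vy * (dy (dv X) p + uy * du (dv X) p + vy * dv (dv X) p))
    - uy * (dy (dy Y) p + uy * du (dy Y) p + vy * dv (dy Y) p + vyy * dv Y p
      + uy * (dy (du Y) p + uy * du (du Y) p + vy * dv (du Y) p)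
      + vy * (dy (dv Y) p + uy * du (dv Y) p + vy * dv (dv Y) p))
    - ut * (dy (dy T) p + uy * du (dy T) p + vy * dv (dy T) p + vyy * dv T p
      + uy * (dy (du T) p + uy * du (du T) p + vy * dv (du T) p)
      + vy * (dy (dv T) p + uy * du (dv T) p + vy * dv (dv T) p))
    - (dx B p + ux * du B p) + vy * (dx Y p + ux * du Y p) + vt * (dx T p + ux * du T p) = 0"
proof -
  obtain x y t u0 v0 where p: "p = (x, y, t, u0, v0)" by (cases p)
  obtain j where s: "solution_jet a b c j" and j: "base j = (x, y, t, u0, v0)"
    "\<And>i k l. j (Deriv DU (i, k, l)) =
       (if k = 0 \<and> l = 0 then cubic u0 ux 0 0 i 0 else 0)
       + (if i = 0 \<and> l = 0 then cubic 0 uy 0 0 k 0 else 0)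
       + (if i = 0 \<and> k = 0 then cubic 0 ut 0 0 l 0 else 0)"
    "\<And>i k l. j (Deriv DV (i, k, l)) =
       (if i = 0 \<and> l = 0 then cubic v0 vy vyy 0 k 0 else 0)
       + (if i = 0 \<and> k = 0 then cubic 0 vt 0 0 l 0 else 0)"
    using polynomial_solution[of uy 0 0] by (metis mult_zero_right)
  show ?thesis
    using Pr4_eq_0(2)[OF s] unfolding Pr4_Delta2_eq[OF smooth_Z] base_total_deriv_def j p[symmetric]
    by (simp add: j eval_nat_numeral algebra_simps)
qed

end

lemma dderiv_of_zero:
  assumes "\<And>q. f q = 0"
  shows "dderiv e f p = 0"
proof -
  have "f = (\<lambda>_. 0)"
    using assms by auto
  then show ?thesis
    by simp
qed

lemma dderiv_zero_commute:
  fixes f :: "'a::euclidean_space \<Rightarrow> real"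
  assumes "smooth_on UNIV f" "e \<in> Basis" "\<And>q. dderiv e f q = 0" "e' \<in> Basis"
  shows "dderiv e (dderiv e' f) p = 0"
proof -
  have "dderiv e (dderiv e' f) p = dderiv e' (dderiv e f) p"
    by (intro dderiv_commute_of_affine smooth_on_differentiable smooth_on_dderiv assms dderiv_of_zero)
  then show ?thesis
    using dderiv_of_zero[of "dderiv e f", OF assms(3)] by simp
qed

context blmp_symmetry
begin

text \<open>These are, up to sign, the coefficients of vyy, ux vyy and ut vyy in
  \<open>Delta2_polynomial\<close>.\<close>

lemma partial_v_zero: "dv A p = 0" "dv X p = 0" "dv T p = 0"
  using Delta2_polynomial[of p 0 0 0 0 0 0] Delta2_polynomial[of p 0 0 1 0 0 0] Delta2_polynomial[of p 0 0 1 1 0 0]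
    Delta2_polynomial[of p 0 0 0 1 0 0] Delta2_polynomial[of p 0 0 1 0 1 0] Delta2_polynomial[of p 0 0 0 0 1 0]
  by simp_all

lemmas partial_v_zero_simps [simp] = partial_v_zero partial_v_zero[THEN dderiv_of_zero]
  dderiv_zero_commute[OF smooth(4) _ partial_v_zero(1), OF coord_dir_basis(2) coord_dir_basis(1)]
  dderiv_zero_commute[OF smooth(4) _ partial_v_zero(1), OF coord_dir_basis(2) coord_dir_basis(2)]
  dderiv_zero_commute[OF smooth(1) _ partial_v_zero(2), OF coord_dir_basis(2) coord_dir_basis(1)]
  dderiv_zero_commute[OF smooth(1) _ partial_v_zero(2), OF coord_dir_basis(2) coord_dir_basis(2)]
  dderiv_zero_commute[OF smooth(3) _ partial_v_zero(3), OF coord_dir_basis(2) coord_dir_basis(1)]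
  dderiv_zero_commute[OF smooth(3) _ partial_v_zero(3), OF coord_dir_basis(2) coord_dir_basis(2)]

text \<open>In order, the coefficients of vt, ux vt, vy, ux vy, uy vyy, ut, the constant term and
  the coefficient of ux.\<close>

lemma Delta2_zero:
  "dx T p = 0" "du T p = 0" "dx Y p = 0" "du Y p = 0" "dv Y p = 0"
  "dy (dy T) p = 0" "dy (dy A) p = dx B p" "dy (dy X) p = - du B p"
  using Delta2_polynomial[of p 0 0 0 0 0 0] Delta2_polynomial[of p 0 0 0 0 0 1] Delta2_polynomial[of p 0 0 0 1 0 1]
    Delta2_polynomial[of p 0 1 0 0 0 0] Delta2_polynomial[of p 0 1 0 1 0 0] Delta2_polynomial[of p 1 0 1 0 0 0]
    Delta2_polynomial[of p 1 0 0 0 0 0] Delta2_polynomial[of p 0 0 0 0 1 0] Delta2_polynomial[of p 0 0 0 1 0 0]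
  by simp_all

lemmas Delta2_zero_simps [simp] = Delta2_zero(1-6) Delta2_zero(1-6)[THEN dderiv_of_zero]
  dderiv_zero_commute[OF smooth(3) _ Delta2_zero(2), OF coord_dir_basis(2) coord_dir_basis(1)]
  dderiv_zero_commute[OF smooth(3) _ Delta2_zero(2), OF coord_dir_basis(2) coord_dir_basis(2)]
  dderiv_zero_commute[OF smooth(3) _ Delta2_zero(1), OF coord_dir_basis(1) coord_dir_basis(1)]
  dderiv_zero_commute[OF smooth(2) _ Delta2_zero(3), OF coord_dir_basis(1) coord_dir_basis(1)]
  dderiv_zero_commute[OF smooth(2) _ Delta2_zero(4), OF coord_dir_basis(2) coord_dir_basis(1)]
  dderiv_zero_commute[OF smooth(2) _ Delta2_zero(5), OF coord_dir_basis(2) coord_dir_basis(1)]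

lemma partial_uu_zero [simp]: "du (du A) p = 0" "du (du X) p = 0"
  and mixed_yu: "du (dy A) p + dy (du A) p = dy (dy Y) p" "du (dy X) p + dy (du X) p = 0"
proof -
  have "uy * (du (dy A) p + dy (du A) p + uy * du (du A) p - dy (dy Y) p)
      = ux * uy * (du (dy X) p + dy (du X) p + uy * du (du X) p)" for ux uy
    using Delta2_polynomial[of p uy 0 0 ux 0 0] by (simp add: Delta2_zero algebra_simps)
  \<comment> \<open>After cancelling uy both sides are affine in uy; the signs of uy separate the
    two coefficients, and ux = 0, 1 separates A from X.\<close>
  from this[of 1 0] this[of "-1" 0] this[of 1 1] this[of "-1" 1]
  show "du (du A) p = 0" "du (du X) p = 0"
    "du (dy A) p + dy (du A) p = dy (dy Y) p" "du (dy X) p + dy (du X) p = 0"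
    by (simp_all add: algebra_simps)
qed

lemma partial_u_commute:
  "du (dderiv (coord_dir (Indep r)) A) p = dderiv (coord_dir (Indep r)) (du A) p"
  "du (dderiv (coord_dir (Indep r)) X) p = dderiv (coord_dir (Indep r)) (du X) p"
  by (intro dderiv_commute_of_affine smooth_on_differentiable smooth_on_dderiv smooth coord_dir_basis partial_uu_zero)+

text \<open>The equation u_yy = v_x eliminates v_x from its own symmetry condition, leaving a linear
  relation between u_yy, u_xy and u_ty. All three vanish on the polynomial solutions, so rational
  ones are needed to exploit it.\<close>

lemma Delta2_jet:
  assumes s: "solution_jet a b c j" and j: "base j = p"
  shows "(du A p - 2 * dy Y p + dx X p - dv B p) * U 0 2 0 j
    - 2 * (dy X p + du X p * U 0 1 0 j) * U 1 1 0 j - 2 * dy T p * U 0 1 1 j = 0"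
proof -
  have "V 1 0 0 j = U 0 2 0 j"
    using s by (auto simp: solution_jet_def is_solution_def Delta2_def)
  moreover have "dy (dy Y) p = 2 * dy (du A) p" "dy (du X) p = 0"
    using mixed_yu[of p] partial_u_commute[of IY p] by simp_all
  ultimately show ?thesis
    using Pr4_eq_0(2)[OF s] unfolding Pr4_Delta2_eq[OF smooth_Z] base_total_deriv_def j
    by (simp add: Delta2_zero partial_u_commute algebra_simps)
qed

text \<open>With \<kappa> = 1 and pole distance 1 / w, the derivatives u_yy, u_xy and u_ty share the
  factor -4 w ^ 3, which is cancelled here.\<close>

lemma Delta2_rational:
  assumes "w \<noteq> 0"
  shows "(du A p - 2 * dy Y p + dx X p - dv B p) * \<rho>\<^sup>2
    - 2 * (dy X p + du X p * 2 * \<rho> * w\<^sup>2) * \<rho>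
    - 2 * dy T p * (a + b * \<rho> + 6 * c * (snd (snd (snd (snd p))) - 2 * \<rho>\<^sup>2 * w\<^sup>2) * \<rho> + 3 * g1) * \<rho> = 0"
    (is "?E = 0")
proof -
  obtain x y t u0 v0 where p: "p = (x, y, t, u0, v0)" by (cases p)
  obtain j where s: "solution_jet a b c j" and j: "base j = p"
    "U 0 2 0 j = - 4 * \<rho>\<^sup>2 * w ^ 3" "U 0 1 0 j = 2 * \<rho> * w\<^sup>2" "U 1 1 0 j = - 4 * \<rho> * w ^ 3"
    "U 0 1 1 j = - 4 * \<rho> * (a + b * \<rho> + 6 * c * (snd (snd (snd (snd p))) - 2 * \<rho>\<^sup>2 * w\<^sup>2) * \<rho> + 3 * g1) * w ^ 3"
    by (rule rational_solution[OF _ refl, where z = "1 / w" and a = a and b = b and c = c and x = x and y = y and t = t and ?u0.0 = u0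
        and ?v0.0 = v0 and \<kappa> = 1 and \<rho> = \<rho> and ?g1.0 = g1 and ?g2.0 = 0]) (use assms in \<open>auto simp: p eval_nat_numeral\<close>)
  have "(- 4 * w ^ 3) * ?E = 0"
    using Delta2_jet[OF s j(1)] unfolding j by (simp only: algebra_simps)
  then show ?thesis
    using assms by simp
qed

lemma Delta2_zero_rational:
  "dy T p = 0" "dy X p = 0" "du X p = 0" "dv B p = du A p - 2 * dy Y p + dx X p"
proof -
  define h where "h = snd (snd (snd (snd p)))"
  note E = Delta2_rational[of _ p, folded h_def]
  \<comment> \<open>Only the term with \<open>dy T\<close> contains g1. Once it is gone, the sign of
    \<rho> isolates \<open>dy X\<close> and a change of w isolates \<open>du X\<close>.\<close>
  show "dy T p = 0"
    using E[of 1 1 0] E[of 1 1 1] by (simp add: algebra_simps)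
  then show "dy X p = 0" "du X p = 0" "dv B p = du A p - 2 * dy Y p + dx X p"
    using E[of 1 1 0] E[of 1 "-1" 0] E[of 2 1 0] by (simp_all add: power2_eq_square)
qed

lemma Delta2_consequences: "du B p = 0" "dy (dy Y) p = 2 * dy (du A) p"
  using Delta2_zero(8)[of p] dderiv_of_zero[of "dy X", OF Delta2_zero_rational(2)] mixed_yu[of p] partial_u_commute[of IY p] by auto

end

section \<open>Fourth prolongation of projectable fields\<close>

text \<open>A class closed under partial derivatives whose total derivatives contain no derivative
  of v; the first four field coefficients lie in it, which keeps repeated prolongation
  short.\<close>

definition affine_u :: "(point \<Rightarrow> real) \<Rightarrow> bool" where
  "affine_u g \<longleftrightarrow> smooth_on UNIV g \<and> du (du g) = (\<lambda>_. 0) \<and> dv g = (\<lambda>_. 0)"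

lemma du_commute:
  assumes "affine_u g" "e \<in> Basis"
  shows "du (dderiv e g) = dderiv e (du g)"
  using assms unfolding affine_u_def
  by (intro ext dderiv_commute_of_affine smooth_on_differentiable smooth_on_dderiv coord_dir_basis) auto

lemma affine_u_dderiv:
  assumes "affine_u g" "e \<in> Basis"
  shows "affine_u (dderiv e g)"
proof -
  have "dv (dderiv e g) = (\<lambda>_. 0)"
    using assms unfolding affine_u_def
    by (intro ext dderiv_zero_commute coord_dir_basis) auto
  moreover have "affine_u (du g)"
    using assms unfolding affine_u_def
    by (auto intro!: ext dderiv_zero_commute smooth_on_dderiv coord_dir_basis)
  then have "du (du (dderiv e g)) = (\<lambda>_. 0)"
    using assms by (simp add: du_commute affine_u_def)
  ultimately show ?thesis
    using assms by (simp add: affine_u_def smooth_on_dderiv)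
qed

lemmas affine_u_d = affine_u_dderiv[OF _ coord_dir_basis(1)] affine_u_dderiv[OF _ coord_dir_basis(2)]
lemmas du_d = du_commute[OF _ coord_dir_basis(1)]

lemma base_total_deriv_affine: "affine_u g \<Longrightarrow> base_total_deriv r g j = dderiv (coord_dir (Indep r)) g (base j) + j (Deriv DU (bump r (0, 0, 0))) * du g (base j)"
  by (simp add: base_total_deriv_def affine_u_def)

lemma has_total_deriv_affine_u:
  assumes "affine_u g"
  shows "has_total_deriv r (\<lambda>j. g (base j))
    (dderiv (coord_dir (Indep r)) g (base j) + j (Deriv DU (bump r (0, 0, 0))) * du g (base j)) j"
  using has_total_deriv_base[of g r j] assms base_total_deriv_affine[OF assms] by (simp add: affine_u_def)

lemmas has_total_deriv_intros = has_total_deriv_diff has_total_deriv_add has_total_deriv_mult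
  has_total_deriv_const has_total_deriv_affine_u has_total_deriv_coord

text \<open>Every symmetry has this shape, and so do the combinations of \<open>v1\<close> to
  \<open>v5\<close>; hence one computation of the prolongation serves both inclusions. B stays
  arbitrary, as v enters the first equation undifferentiated.\<close>

locale projectable_field = vector_field +
  assumes smooth_Z: "smooth_on UNIV Z"
    and partials_zero [simp]: "dy X = (\<lambda>_. 0)" "du X = (\<lambda>_. 0)" "dv X = (\<lambda>_. 0)"
      "dx Y = (\<lambda>_. 0)" "du Y = (\<lambda>_. 0)" "dv Y = (\<lambda>_. 0)"
      "dx T = (\<lambda>_. 0)" "dy T = (\<lambda>_. 0)" "du T = (\<lambda>_. 0)" "dv T = (\<lambda>_. 0)"
      "dv A = (\<lambda>_. 0)" "du (du A) = (\<lambda>_. 0)"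
begin

lemmas smooth = smooth_on_components[OF smooth_Z]

lemma partials_zero2 [simp]:
  "dx (dy Y) = (\<lambda>_. 0)" "dy (dt X) = (\<lambda>_. 0)" "dy (dx X) = (\<lambda>_. 0)" "dy (dt T) = (\<lambda>_. 0)"
  by (intro ext dderiv_zero_commute smooth coord_dir_basis; simp)+

lemma affine_u_components: "affine_u X" "affine_u Y" "affine_u T" "affine_u A"
  by (auto simp: affine_u_def smooth)

lemmas affine_u = affine_u_components affine_u_components[THEN affine_u_d(1)] affine_u_d

lemmas prolong_simps = affine_u_components[THEN base_total_deriv_affine]

text \<open>In this family, coefficients that are prolonged further are given as functions on jets,
  the final ones at a single jet.\<close>

lemma prolong_u_100:
  "prolong_coeff Z DU (Suc 0, 0, 0) = (\<lambda>j. dx A (base j) + U 1 0 0 j * du A (base j) - U 1 0 0 j * dx X (base j))"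
  unfolding prolong_coeff.simps(2) prolong_coeff_zero
  by (rule ext, rule prolong_stepI[OF smooth_Z], rule has_total_deriv_affine_u[OF affine_u(4)]) (simp add: prolong_simps)

lemma prolong_u_200:
  "prolong_coeff Z DU (Suc (Suc 0), 0, 0) j = dx (dx A) (base j) + 2 * U 1 0 0 j * dx (du A) (base j)
    - U 1 0 0 j * dx (dx X) (base j) + U 2 0 0 j * (du A (base j) - 2 * dx X (base j))"
  unfolding prolong_coeff.simps(2)[of _ _ "Suc 0"] prolong_u_100
  by (rule prolong_stepI[OF smooth_Z],
      ((rule has_total_deriv_intros affine_u | (simp; fail))+)[1])
    (simp add: prolong_simps du_d affine_u eval_nat_numeral algebra_simps)

lemma prolong_u_010:
  "prolong_coeff Z DU (0, Suc 0, 0) = (\<lambda>j. dy A (base j) + U 0 1 0 j * du A (base j) - U 0 1 0 j * dy Y (base j))"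
  unfolding prolong_coeff.simps(3) prolong_coeff_zero
  by (rule ext, rule prolong_stepI[OF smooth_Z], rule has_total_deriv_affine_u[OF affine_u(4)]) (simp add: prolong_simps)

lemma prolong_u_110:
  "prolong_coeff Z DU (Suc 0, Suc 0, 0) = (\<lambda>j. dx (dy A) (base j) + U 1 0 0 j * dy (du A) (base j)
    + U 0 1 0 j * dx (du A) (base j) + U 1 1 0 j * (du A (base j) - dy Y (base j) - dx X (base j)))"
  unfolding prolong_coeff.simps(2)[of _ _ 0 "Suc 0"] prolong_u_010
  by (rule ext, rule prolong_stepI[OF smooth_Z],
      ((rule has_total_deriv_intros affine_u | (simp; fail))+)[1])
    (simp add: prolong_simps du_d affine_u eval_nat_numeral algebra_simps)

lemma prolong_u_210:
  "prolong_coeff Z DU (Suc (Suc 0), Suc 0, 0) = (\<lambda>j. dx (dx (dy A)) (base j)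
    + 2 * (U 1 0 0 j * dx (dy (du A)) (base j)) + U 2 0 0 j * dy (du A) (base j)
    + U 0 1 0 j * dx (dx (du A)) (base j) + U 1 1 0 j * (2 * dx (du A) (base j) - dx (dx X) (base j))
    + U 2 1 0 j * (du A (base j) - dy Y (base j) - 2 * dx X (base j)))"
  unfolding prolong_coeff.simps(2)[of _ _ "Suc 0" "Suc 0"] prolong_u_110
  by (rule ext, rule prolong_stepI[OF smooth_Z],
      ((rule has_total_deriv_intros affine_u | (simp; fail))+)[1])
    (simp add: prolong_simps du_d affine_u eval_nat_numeral algebra_simps)

lemma prolong_u_310:
  "prolong_coeff Z DU (Suc (Suc (Suc 0)), Suc 0, 0) j = dx (dx (dx (dy A))) (base j)
    + 3 * U 1 0 0 j * dx (dx (dy (du A))) (base j) + 3 * U 2 0 0 j * dx (dy (du A)) (base j)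
    + U 3 0 0 j * dy (du A) (base j) + U 0 1 0 j * dx (dx (dx (du A))) (base j)
    + U 1 1 0 j * (3 * dx (dx (du A)) (base j) - dx (dx (dx X)) (base j))
    + U 2 1 0 j * (3 * dx (du A) (base j) - 3 * dx (dx X) (base j))
    + U 3 1 0 j * (du A (base j) - dy Y (base j) - 3 * dx X (base j))"
  unfolding prolong_coeff.simps(2)[of _ _ "Suc (Suc 0)" "Suc 0"] prolong_u_210
  by (rule prolong_stepI[OF smooth_Z],
      ((rule has_total_deriv_intros affine_u | (simp; fail))+)[1])
    (simp add: prolong_simps du_d affine_u eval_nat_numeral algebra_simps)

lemma prolong_u_001:
  "prolong_coeff Z DU (0, 0, Suc 0) = (\<lambda>j. dt A (base j) + U 0 0 1 j * du A (base j)
    - U 1 0 0 j * dt X (base j) - U 0 1 0 j * dt Y (base j) - U 0 0 1 j * dt T (base j))"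
  unfolding prolong_coeff.simps(4) prolong_coeff_zero
  by (rule ext, rule prolong_stepI[OF smooth_Z], rule has_total_deriv_affine_u[OF affine_u(4)]) (simp add: prolong_simps)

lemma prolong_u_011:
  "prolong_coeff Z DU (0, Suc 0, Suc 0) j = dy (dt A) (base j) + U 0 1 0 j * dt (du A) (base j)
    + U 0 0 1 j * dy (du A) (base j) + U 0 1 1 j * (du A (base j) - dt T (base j) - dy Y (base j))
    - U 1 1 0 j * dt X (base j) - U 0 1 0 j * dy (dt Y) (base j) - U 0 2 0 j * dt Y (base j)"
  unfolding prolong_coeff.simps(3)[of _ _ 0 "Suc 0"] prolong_u_001
  by (rule prolong_stepI[OF smooth_Z],
      ((rule has_total_deriv_intros affine_u | (simp; fail))+)[1])
    (simp add: prolong_simps du_d affine_u eval_nat_numeral algebra_simps)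

lemma prolong_u_020:
  "prolong_coeff Z DU (0, Suc (Suc 0), 0) = (\<lambda>j. dy (dy A) (base j)
    + U 0 1 0 j * (2 * dy (du A) (base j) - dy (dy Y) (base j)) + U 0 2 0 j * (du A (base j) - 2 * dy Y (base j)))"
  unfolding prolong_coeff.simps(3)[of _ _ "Suc 0" 0] prolong_u_010
  by (rule ext, rule prolong_stepI[OF smooth_Z],
      ((rule has_total_deriv_intros affine_u | (simp; fail))+)[1])
    (simp add: prolong_simps du_d affine_u eval_nat_numeral algebra_simps)

lemma prolong_u_030:
  "prolong_coeff Z DU (0, Suc (Suc (Suc 0)), 0) = (\<lambda>j. dy (dy (dy A)) (base j)
    + U 0 1 0 j * (3 * dy (dy (du A)) (base j) - dy (dy (dy Y)) (base j))
    + U 0 2 0 j * (3 * dy (du A) (base j) - 3 * dy (dy Y) (base j))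
    + U 0 3 0 j * (du A (base j) - 3 * dy Y (base j)))"
  unfolding prolong_coeff.simps(3)[of _ _ "Suc (Suc 0)" 0] prolong_u_020
  by (rule ext, rule prolong_stepI[OF smooth_Z],
      ((rule has_total_deriv_intros affine_u | (simp; fail))+)[1])
    (simp add: prolong_simps du_d affine_u eval_nat_numeral algebra_simps)

lemma prolong_u_040:
  "prolong_coeff Z DU (0, Suc (Suc (Suc (Suc 0))), 0) j = dy (dy (dy (dy A))) (base j)
    + U 0 1 0 j * (4 * dy (dy (dy (du A))) (base j) - dy (dy (dy (dy Y))) (base j))
    + U 0 2 0 j * (6 * dy (dy (du A)) (base j) - 4 * dy (dy (dy Y)) (base j))
    + U 0 3 0 j * (4 * dy (du A) (base j) - 6 * dy (dy Y) (base j))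
    + U 0 4 0 j * (du A (base j) - 4 * dy Y (base j))"
  unfolding prolong_coeff.simps(3)[of _ _ "Suc (Suc (Suc 0))" 0] prolong_u_030
  by (rule prolong_stepI[OF smooth_Z],
      ((rule has_total_deriv_intros affine_u | (simp; fail))+)[1])
    (simp add: prolong_simps du_d affine_u eval_nat_numeral algebra_simps)

lemma numeral_4_eq_4: "4 = Suc (Suc (Suc (Suc 0)))"
  by simp

lemmas prolong_u = prolong_u_100 prolong_u_200 prolong_u_010 prolong_u_110 prolong_u_310 prolong_u_011 prolong_u_020 prolong_u_040

end

text \<open>Only the symmetry condition for u_yy = v_x has been used up to here.\<close>

sublocale blmp_symmetry \<subseteq> projectable_field
  by unfold_locales (auto simp: smooth_Z Delta2_zero_rational Delta2_consequences)

section \<open>Conditions from the fourth-order equation\<close>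

context blmp_symmetry
begin

text \<open>Here u_y = 0, so that uxx and uxxx are free as well.\<close>

lemma Delta1_polynomial:
  "dy (dt A) p + ut * dy (du A) p - a * (dx (dy A) p + ux * dy (du A) p) - b * dy (dy A) p
    + dx (dx (dx (dy A))) p + 3 * ux * dx (dx (dy (du A))) p + 3 * uxx * dx (dy (du A)) p + uxxx * dy (du A) p
    + c * (dy (dy (dy (dy A))) p - 6 * snd (snd (snd (snd p))) * dy (dy A) p)
    - 3 * (dy A p * uxx + ux * (dx (dy A) p + ux * dy (du A) p)) = 0"
proof -
  obtain x y t u0 v0 where p: "p = (x, y, t, u0, v0)" by (cases p)
  obtain j where s: "solution_jet a b c j" and j: "base j = (x, y, t, u0, v0)"
    "\<And>i k l. j (Deriv DU (i, k, l)) =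
       (if k = 0 \<and> l = 0 then cubic u0 ux uxx uxxx i 0 else 0)
       + (if i = 0 \<and> l = 0 then cubic 0 0 0 0 k 0 else 0)
       + (if i = 0 \<and> k = 0 then cubic 0 ut 0 0 l 0 else 0)"
    "\<And>i k l. j (Deriv DV (i, k, l)) =
       (if i = 0 \<and> l = 0 then cubic v0 0 0 0 k 0 else 0)
       + (if i = 0 \<and> k = 0 then cubic 0 0 0 0 l 0 else 0)"
    using polynomial_solution[of 0 uxx uxxx] by (metis mult_zero_left)
  show ?thesis
    using Pr4_eq_0(1)[OF s] unfolding Pr4_Delta1 Let_def numeral_2_eq_2 numeral_3_eq_3 numeral_4_eq_4 One_nat_def prolong_u j p
    by (simp add: j p eval_nat_numeral algebra_simps)
qed

text \<open>The coefficient of uxxx is \<open>dy (du A)\<close>; that of uxx is three times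
  \<open>dx (dy (du A)) - dy A\<close>.\<close>

lemma partial_y_zero: "dy (du A) p = 0" "dy A p = 0"
proof -
  show *: "dy (du A) p = 0" for p
    using Delta1_polynomial[of p 0 0 0 0] Delta1_polynomial[of p 0 0 0 1] by simp
  have "dx (dy (du A)) p = 0" by (rule dderiv_of_zero) (rule *)
  then show "dy A p = 0"
    using Delta1_polynomial[of p 0 0 0 0] Delta1_polynomial[of p 0 0 1 0] by simp
qed

lemma partials_zero3 [simp]: "dy (du A) = (\<lambda>_. 0)" "dy A = (\<lambda>_. 0)" "dy (dy Y) = (\<lambda>_. 0)" "dy (dt A) = (\<lambda>_. 0)"
proof -
  show "dy (du A) = (\<lambda>_. 0)" "dy A = (\<lambda>_. 0)"
    using partial_y_zero by auto
  then show "dy (dy Y) = (\<lambda>_. 0)"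
    by (intro ext) (simp add: Delta2_consequences)
  show "dy (dt A) = (\<lambda>_. 0)"
    by (intro ext dderiv_zero_commute smooth coord_dir_basis partial_y_zero)
qed

text \<open>The symmetry condition on the rational solution with \<open>\<kappa> = 1\<close> and pole distance \<open>\<zeta> = 1 / w\<close>,
  divided by \<open>2 \<rho> w\<^sup>2\<close>.\<close>

lemma Delta1_rational:
  fixes p w \<rho> g1
  defines "v \<equiv> snd (snd (snd (snd p)))"
  defines "m \<equiv> a + b * \<rho> + 6 * c * (v - 2 * \<rho>\<^sup>2 * w\<^sup>2) * \<rho> + 3 * g1"
  assumes w: "w \<noteq> 0" and \<rho>: "\<rho> \<noteq> 0"
  shows "dt (du A) p - dy (dt Y) p - 2 * w * ((du A p - dy Y p - dt T p) * m - dt X p - \<rho> * dt Y p)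
    - a * (dx (du A) p - 2 * w * (du A p - dy Y p - dx X p))
    + 2 * b * \<rho> * w * (du A p - 2 * dy Y p)
    + dx (dx (dx (du A))) p - 2 * w * (3 * dx (dx (du A)) p - dx (dx (dx X)) p)
    + 18 * w\<^sup>2 * (dx (du A) p - dx (dx X) p) - 24 * w ^ 3 * (du A p - dy Y p - 3 * dx X p)
    - 24 * c * \<rho> ^ 3 * w ^ 3 * (du A p - 4 * dy Y p)
    + 12 * c * \<rho> * w * (v * (du A p - 2 * dy Y p) + B p)
    - 3 * (dx (dx A) p + (2 * w\<^sup>2 + g1) * (2 * dx (du A) p - dx (dx X) p) - 4 * w ^ 3 * (du A p - 2 * dx X p))
    + 12 * w ^ 3 * (du A p - dy Y p)
    - 3 * (2 * w\<^sup>2 + g1) * (dx (du A) p - 2 * w * (du A p - dy Y p - dx X p))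
    + 6 * w * (dx A p + (du A p - dx X p) * (2 * w\<^sup>2 + g1)) = 0"
    (is "?E = 0")
proof -
  obtain x y t u0 v0 where p: "p = (x, y, t, u0, v0)" by (cases p)
  have z: "1 / w \<noteq> 0" using w by simp
  obtain j where s: "solution_jet a b c j" and j: "base j = p"
    "U 1 0 0 j = 2 * w\<^sup>2 + g1" "U 2 0 0 j = - 4 * w ^ 3"
    "U 0 1 0 j = 2 * \<rho> * w\<^sup>2" "U 1 1 0 j = - 4 * \<rho> * w ^ 3" "U 0 2 0 j = - 4 * \<rho>\<^sup>2 * w ^ 3"
    "U 0 1 1 j = - 4 * \<rho> * m * w ^ 3" "U 2 1 0 j = 12 * \<rho> * w ^ 4" "U 3 1 0 j = - 48 * \<rho> * w ^ 5"
    "U 0 4 0 j = - 48 * \<rho> ^ 4 * w ^ 5" "V 0 0 0 j = v"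
    by (rule rational_solution[OF z refl, where a = a and b = b and c = c and x = x and y = y and t = t and ?u0.0 = u0
        and ?v0.0 = v0 and \<kappa> = 1 and \<rho> = \<rho> and ?g1.0 = g1 and ?g2.0 = 0])
      (auto simp: p m_def v_def eval_nat_numeral)
  have "(2 * \<rho> * w\<^sup>2) * ?E = 0"
    using Pr4_eq_0(1)[OF s] unfolding Pr4_Delta1 Let_def numeral_2_eq_2 numeral_3_eq_3 numeral_4_eq_4 One_nat_def prolong_u
    by (simp add: j[unfolded numeral_2_eq_2 numeral_3_eq_3 numeral_4_eq_4 One_nat_def] eval_nat_numeral algebra_simps)
  then show ?thesis
    using w \<rho> by simp
qed

end

text \<open>Evaluation at eight points gives a nonsingular linear system for the eight
  coefficients.\<close>

lemma coefficients_eq_0: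
  fixes c0 d0 c1 d1 e1 c2 c3 e3 :: real
  assumes "\<forall>w r g. w \<noteq> 0 \<longrightarrow> r \<noteq> 0 \<longrightarrow>
    c0 + d0 * g + w * (c1 + d1 * g + e1 * r) + w\<^sup>2 * c2 + w ^ 3 * (c3 + e3 * r ^ 3) = 0"
  shows "c0 = 0" "d0 = 0" "c1 = 0" "d1 = 0" "e1 = 0" "c2 = 0" "c3 = 0" "e3 = 0"
proof -
  note E = assms[rule_format, of 1 1 0] assms[rule_format, of "-1" 1 0] assms[rule_format, of 2 1 0] assms[rule_format, of "-2" 1 0]
    assms[rule_format, of 1 "-1" 0] assms[rule_format, of 2 "-1" 0] assms[rule_format, of 1 1 1] assms[rule_format, of 2 1 1]
  show "c0 = 0" "d0 = 0" "c1 = 0" "d1 = 0" "e1 = 0" "c2 = 0" "c3 = 0" "e3 = 0"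
    using E by simp_all
qed

lemma dderiv_lincomb:
  fixes f g :: "'a::euclidean_space \<Rightarrow> real"
  assumes "f differentiable (at p)" "g differentiable (at p)"
  shows "dderiv e (\<lambda>q. k * f q + l * g q) p = k * dderiv e f p + l * dderiv e g p"
proof -
  have "(f has_derivative frechet_derivative f (at p)) (at p)" "(g has_derivative frechet_derivative g (at p)) (at p)"
    using assms frechet_derivative_works by blast+
  then have "((\<lambda>q. k * f q + l * g q) has_derivative
      (\<lambda>h. k * frechet_derivative f (at p) h + l * frechet_derivative g (at p) h)) (at p)"
    by (intro has_derivative_add has_derivative_mult_right)
  then show ?thesis
    by (simp add: dderiv_eqI) (simp add: dderiv_def)
qed

text \<open>One coordinate is moved to 0 at a time. The dependence on t is left in the value at (0,
  0, t, 0, 0), the point at which \<open>F1\<close>, \<open>F2\<close>, \<open>F3\<close> are read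
  off.\<close>

lemma const_partials_imp_affine:
  fixes f :: "point \<Rightarrow> real"
  assumes f: "\<And>q. f differentiable (at q)"
    and d: "\<And>q. dx f q = k1" "\<And>q. dy f q = k2" "\<And>q. du f q = k4" "\<And>q. dv f q = k5"
  shows "f (x, y, t, u, v) = f (0, 0, t, 0, 0) + k1 * x + k2 * y + k4 * u + k5 * v"
  using dderiv_const_imp_affine[OF f, where p = "(0, y, t, u, v)" and r = x, OF d(1)]
    dderiv_const_imp_affine[OF f, where p = "(0, 0, t, u, v)" and r = y, OF d(2)]
    dderiv_const_imp_affine[OF f, where p = "(0, 0, t, 0, v)" and r = u, OF d(3)]
    dderiv_const_imp_affine[OF f, where p = "(0, 0, t, 0, 0)" and r = v, OF d(4)]
  by (simp add: coord_dir.simps)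

lemma dt_const_imp_affine:
  fixes f :: "point \<Rightarrow> real"
  assumes f: "\<And>q. f differentiable (at q)" and d: "\<And>q. dt f q = k"
  shows "f (0, 0, t, 0, 0) = f (0, 0, 0, 0, 0) + k * t"
  using dderiv_const_imp_affine[OF f, where p = "(0, 0, 0, 0, 0)" and r = t, OF d]
  by (simp add: coord_dir.simps)

section \<open>Splitting and integrating the determining equations\<close>

context blmp_symmetry
begin

text \<open>At fixed p, \<open>Delta1_rational\<close> is a polynomial identity in w, \<rho> and g1.
  Its coefficients give differential equations for the field and tie the scaling weights of x, y, t
  and u together.\<close>

lemma determining_equations:
  fixes p
  defines "v \<equiv> snd (snd (snd (snd p)))"
  shows "dt (du A) p - dy (dt Y) p - a * dx (du A) p + dx (dx (dx (du A))) p - 3 * dx (dx A) p = 0"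
    and "- 2 * ((du A p - dy Y p - dt T p) * a - dt X p) + 2 * a * (du A p - dy Y p - dx X p)
      - 2 * (3 * dx (dx (du A)) p - dx (dx (dx X)) p) + 6 * dx A p = 0"
    and "- 2 * ((du A p - dy Y p - dt T p) * (b + 6 * c * v) - dt Y p) + 2 * b * (du A p - 2 * dy Y p)
      + 12 * c * (v * (du A p - 2 * dy Y p) + B p) = 0"
    and "dx (dx X) p = 0"
    and "dx X p = dy Y p" "du A p = - dx X p" "dt T p = 3 * dx X p"
proof -
  have "\<forall>w r g. w \<noteq> 0 \<longrightarrow> r \<noteq> 0 \<longrightarrow> (dt (du A) p - dy (dt Y) p - a * dx (du A) p + dx (dx (dx (du A))) p - 3 * dx (dx A) p)
    + (- 3 * (2 * dx (du A) p - dx (dx X) p) - 3 * dx (du A) p) * g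
    + w * ((- 2 * ((du A p - dy Y p - dt T p) * a - dt X p) + 2 * a * (du A p - dy Y p - dx X p)
        - 2 * (3 * dx (dx (du A)) p - dx (dx (dx X)) p) + 6 * dx A p)
      + (- 6 * (du A p - dy Y p - dt T p) + 6 * (du A p - dy Y p - dx X p) + 6 * (du A p - dx X p)) * g
      + (- 2 * ((du A p - dy Y p - dt T p) * (b + 6 * c * v) - dt Y p) + 2 * b * (du A p - 2 * dy Y p)
        + 12 * c * (v * (du A p - 2 * dy Y p) + B p)) * r)
    + w\<^sup>2 * (- 12 * dx (dx X) p)
    + w ^ 3 * (24 * (du A p + dx X p) + 24 * c * (3 * dy Y p - dt T p) * r ^ 3) = 0"
  proof (intro allI impI, goal_cases)
    case (1 w r g)
    then show ?case
      using Delta1_rational[of w r p g] unfolding v_def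
      by (simp add: algebra_simps power2_eq_square power3_eq_cube)
  qed
  note C = coefficients_eq_0[OF this]
  show "dt (du A) p - dy (dt Y) p - a * dx (du A) p + dx (dx (dx (du A))) p - 3 * dx (dx A) p = 0"
    by (fact C(1))
  show "- 2 * ((du A p - dy Y p - dt T p) * a - dt X p) + 2 * a * (du A p - dy Y p - dx X p)
      - 2 * (3 * dx (dx (du A)) p - dx (dx (dx X)) p) + 6 * dx A p = 0"
    by (fact C(3))
  show "- 2 * ((du A p - dy Y p - dt T p) * (b + 6 * c * v) - dt Y p) + 2 * b * (du A p - 2 * dy Y p)
      + 12 * c * (v * (du A p - 2 * dy Y p) + B p) = 0"
    by (fact C(5))
  show "dx (dx X) p = 0"
    using C(6) by simp
  \<comment> \<open>The two parts of the w ^ 3 coefficient relate u to x and t to y. The coefficient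
    of w g1 then closes the system by relating t to x.\<close>
  have "du A p + dx X p = 0"
    using C(7) by simp
  then show "du A p = - dx X p"
    by simp
  moreover have "3 * dy Y p - dt T p = 0"
    using C(8) c by simp
  ultimately show "dx X p = dy Y p" "dt T p = 3 * dx X p"
    using C(4) by argo+
qed

lemma differentiable: "dx X differentiable (at p)" "dt X differentiable (at p)"
  by (intro smooth_on_differentiable smooth_on_dderiv smooth coord_dir_basis)+

text \<open>The redundant second summand fits the shape of \<open>dderiv_lincomb\<close>.\<close>

lemma du_A: "du A = (\<lambda>q. - 1 * dx X q + 0 * dx X q)"
  using determining_equations(6) by auto

lemma partials_zero4 [simp]: "dx (dx X) = (\<lambda>_. 0)" "dx (du A) = (\<lambda>_. 0)"
proof -
  show *: "dx (dx X) = (\<lambda>_. 0)"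
    using determining_equations(4) by auto
  have "dx (du A) p = - 1 * dx (dx X) p + 0 * dx (dx X) p" for p
    unfolding du_A by (intro dderiv_lincomb differentiable)
  then show "dx (du A) = (\<lambda>_. 0)"
    using * by auto
qed

lemma dx_A: "dx A p = - (2 * a / 3) * dx X p + - (1 / 3) * dt X p"
  using determining_equations(2,5,6,7)[of p] by (simp add: algebra_simps)

lemma B_eq: "12 * c * B p = - 4 * b * dx X p - 24 * c * snd (snd (snd (snd p))) * dx X p - 2 * dt Y p"
  using determining_equations(3,5,6,7)[of p] by (simp add: algebra_simps)

text \<open>In the first determining equation the u-derivative of A, the y-derivative of Y and A_xx
  contribute -1, -1 and +1 times X_xt, and everything else vanishes. This makes the scaling factor
  independent of time.\<close>

lemma dt_dx_X: "dt (dx X) p = 0"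
proof -
  note sm = smooth_on_differentiable smooth_on_dderiv smooth coord_dir_basis
  have 1: "dt (du A) p = - 1 * dt (dx X) p + 0 * dt (dx X) p"
    unfolding du_A by (intro dderiv_lincomb differentiable)
  have "dy Y = dx X"
    using determining_equations(5) by auto
  moreover have "dy (dt Y) p = dt (dy Y) p"
    by (intro dderiv_commute_of_affine sm) simp
  ultimately have 2: "dy (dt Y) p = dt (dx X) p"
    by simp
  have A: "dx A = (\<lambda>q. - (2 * a / 3) * dx X q + - (1 / 3) * dt X q)"
    using dx_A by auto
  have "dx (dx A) p = - (2 * a / 3) * dx (dx X) p + - (1 / 3) * dx (dt X) p"
    unfolding A by (intro dderiv_lincomb differentiable)
  moreover have "dx (dt X) p = dt (dx X) p"
    by (intro dderiv_commute_of_affine sm) simp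
  ultimately show ?thesis
    using determining_equations(1)[of p] 1 2 by simp
qed

lemma dx_X_const: "dx X p = dx X 0"
proof -
  obtain x y t u v where p: "p = (x, y, t, u, v)" by (cases p)
  have d: "dx X differentiable (at q)" for q
    by (intro smooth_on_differentiable smooth_on_dderiv smooth coord_dir_basis)
  have "du (dx X) q = 0" "dv (dx X) q = 0" for q
    by (rule dderiv_zero_commute[OF smooth(1)]; simp add: coord_dir_basis)+
  then show ?thesis
    using const_partials_imp_affine[OF d, of 0 0 0 0 x y t u v] dt_const_imp_affine[OF d, of 0 t] dt_dx_X
    by (simp add: p zero_prod_def)
qed

lemma general_form:
  assumes "F1 Z constant_on UNIV" "F2 Z constant_on UNIV" "F3 Z constant_on UNIV"
  shows "\<exists>a1 a2 a3 a4 a5. Z = vf_scale a1 (v1 a b c) + vf_scale a2 v2 + vf_scale a3 v3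
             + vf_scale a4 v4 + vf_scale a5 v5"
proof -
  obtain f1 f2 f3 where F: "X (0, 0, t, 0, 0) = f1" "Y (0, 0, t, 0, 0) = f2" "A (0, 0, t, 0, 0) = f3" for t
    using assms unfolding constant_on_def F1_def F2_def F3_def by (metis UNIV_I)
  \<comment> \<open>This is one third of the constant g1 of the general symmetry, so
    \<open>v1\<close> receives the coefficient \<open>3 * s\<close>.\<close>
  define s where "s = dx X 0"
  have s: "dx X p = s" "dy Y p = s" "dt T p = 3 * s" "du A p = - s" for p
    using dx_X_const[of p] determining_equations(5-7)[of p] by (auto simp: s_def)
  note d = smooth[THEN smooth_on_differentiable]
  have X: "X (x, y, t, u, v) = f1 + s * x" for x y t u v
    using const_partials_imp_affine[OF d(1), of s 0 0 0 x y t u v] by (simp add: s F)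
  have Y: "Y (x, y, t, u, v) = f2 + s * y" for x y t u v
    using const_partials_imp_affine[OF d(2), of 0 s 0 0 x y t u v] by (simp add: s F)
  have T: "T (x, y, t, u, v) = T 0 + 3 * s * t" for x y t u v
    using const_partials_imp_affine[OF d(3), of 0 0 0 0 x y t u v] dt_const_imp_affine[OF d(3), of "3 * s" t]
    by (simp add: s zero_prod_def)
  \<comment> \<open>Constancy of \<open>F1\<close> and \<open>F2\<close> removes \<open>dt X\<close>
    and \<open>dt Y\<close>, through which time-dependent translations would enter A and B.\<close>
  have "X = (\<lambda>p. f1 + s * fst p)" "Y = (\<lambda>p. f2 + s * fst (snd p))"
    using X Y by auto
  moreover have "dderiv e (\<lambda>p. f1 + s * fst p) p = s * fst e"
    "dderiv e (\<lambda>p. f2 + s * fst (snd p)) p = s * fst (snd e)" for e p :: point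
    by (rule dderiv_eqI, auto intro!: derivative_eq_intros)+
  ultimately have t: "dt X p = 0" "dt Y p = 0" for p
    by (simp_all only: coord_dir.simps) auto
  have A: "A (x, y, t, u, v) = f3 - 2 * a / 3 * s * x - s * u" for x y t u v
    using const_partials_imp_affine[OF d(4), of "- (2 * a / 3) * s" 0 "- s" 0 x y t u v] by (simp add: s F dx_A t)
  have B: "B (x, y, t, u, v) = - (b / (3 * c)) * s - 2 * v * s" for x y t u v
    using B_eq[of "(x, y, t, u, v)"] c by (simp add: s t field_simps)
  have Z: "Z p = (X p, Y p, T p, A p, B p)" for p
    by (simp add: xi_x_def xi_y_def xi_t_def eta_u_def eta_v_def case_prod_unfold)
  have "Z = vf_scale (3 * s) (v1 a b c) + vf_scale (T 0) v2 + vf_scale f1 v3 + vf_scale f2 v4 + vf_scale f3 v5"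
  proof (rule ext)
    fix p :: point
    obtain x y t u v where p: "p = (x, y, t, u, v)" by (cases p)
    have "- (b / (3 * c)) * s - 2 * v * s = 3 * s * ((- 12 * c * v - 2 * b) / (18 * c))"
      using c by (simp add: field_simps)
    then show "Z p = (vf_scale (3 * s) (v1 a b c) + vf_scale (T 0) v2 + vf_scale f1 v3 + vf_scale f2 v4 + vf_scale f3 v5) p"
      by (simp add: Z p X Y T A B vf_scale_def v1_def v2_def v3_def v4_def v5_def) (simp add: algebra_simps)
  qed
  then show ?thesis
    by blast
qed

end

section \<open>The five-dimensional algebra\<close>

lemma fold_dderiv_const: "fold dderiv es (\<lambda>_. k) differentiable_on UNIV"
proof (induction es arbitrary: k)
  case (Cons e es)
  then show ?case
    by simp
qed simp

text \<open>One L serves all points, so first partial derivatives are constant.\<close>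

lemma smooth_on_affine:
  assumes "\<And>p. (f has_derivative L) (at p)"
  shows "smooth_on UNIV f"
proof -
  have "fold dderiv es f differentiable_on UNIV" for es
  proof (cases es)
    case Nil
    then show ?thesis
      using assms by (auto simp: differentiable_on_def differentiable_def)
  next
    case (Cons e es')
    have "dderiv e f = (\<lambda>_. L e)"
      using assms by (auto intro: dderiv_eqI)
    then show ?thesis
      using fold_dderiv_const by (simp add: Cons)
  qed
  then show ?thesis
    by (simp add: smooth_on_def)
qed

text \<open>Parametrizing the combinations turns the vector space and Lie algebra laws into
  arithmetic of five real parameters.\<close>

definition sym_field :: "real \<Rightarrow> real \<Rightarrow> real \<Rightarrow> real \<Rightarrow> real \<Rightarrow> real \<Rightarrow> real \<Rightarrow> real \<Rightarrow> vfield" where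
  "sym_field a b c a1 a2 a3 a4 a5 = vf_scale a1 (v1 a b c) + vf_scale a2 v2 + vf_scale a3 v3
     + vf_scale a4 v4 + vf_scale a5 v5"

lemma sym_field_eq:
  assumes "c \<noteq> 0"
  shows "sym_field a b c a1 a2 a3 a4 a5 = (\<lambda>p.
    (a1 / 3 * fst p + a3, a1 / 3 * fst (snd p) + a4, a1 * fst (snd (snd p)) + a2,
     a5 - 2 * a * a1 / 9 * fst p - a1 / 3 * fst (snd (snd (snd p))),
     - (2 * a1 / 3) * snd (snd (snd (snd p))) - a1 * b / (9 * c)))"
  using assms by (auto simp: sym_field_def vf_scale_def v1_def v2_def v3_def v4_def v5_def field_simps)

text \<open>The common derivative at all points; it involves only \<open>a1\<close> because
  \<open>v2\<close> to \<open>v5\<close> are constant fields.\<close>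

definition sym_field_lin :: "real \<Rightarrow> real \<Rightarrow> point \<Rightarrow> point" where
  "sym_field_lin a a1 h = (a1 / 3 * fst h, a1 / 3 * fst (snd h), a1 * fst (snd (snd h)),
     - (2 * a * a1 / 9) * fst h - a1 / 3 * fst (snd (snd (snd h))), - (2 * a1 / 3) * snd (snd (snd (snd h))))"

lemma has_derivative_sym_field:
  assumes "c \<noteq> 0"
  shows "(sym_field a b c a1 a2 a3 a4 a5 has_derivative sym_field_lin a a1) (at p)"
  unfolding sym_field_eq[OF assms] sym_field_lin_def[abs_def]
  by (auto intro!: derivative_eq_intros simp: fun_eq_iff algebra_simps)

context
  fixes a b c :: real
  assumes c: "c \<noteq> 0"
begin

lemma sym_field_components:
  "xi_x (sym_field a b c a1 a2 a3 a4 a5) = (\<lambda>p. a1 / 3 * fst p + a3)"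
  "xi_y (sym_field a b c a1 a2 a3 a4 a5) = (\<lambda>p. a1 / 3 * fst (snd p) + a4)"
  "xi_t (sym_field a b c a1 a2 a3 a4 a5) = (\<lambda>p. a1 * fst (snd (snd p)) + a2)"
  "eta_u (sym_field a b c a1 a2 a3 a4 a5) = (\<lambda>p. a5 - 2 * a * a1 / 9 * fst p - a1 / 3 * fst (snd (snd (snd p))))"
  "eta_v (sym_field a b c a1 a2 a3 a4 a5) = (\<lambda>p. - (2 * a1 / 3) * snd (snd (snd (snd p))) - a1 * b / (9 * c))"
  unfolding sym_field_eq[OF c]
  by (auto simp: xi_x_def xi_y_def xi_t_def eta_u_def eta_v_def)

lemma dderiv_components:
  "dderiv e (xi_x (sym_field a b c a1 a2 a3 a4 a5)) = (\<lambda>_. a1 / 3 * fst e)"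
  "dderiv e (xi_y (sym_field a b c a1 a2 a3 a4 a5)) = (\<lambda>_. a1 / 3 * fst (snd e))"
  "dderiv e (xi_t (sym_field a b c a1 a2 a3 a4 a5)) = (\<lambda>_. a1 * fst (snd (snd e)))"
  "dderiv e (eta_u (sym_field a b c a1 a2 a3 a4 a5)) = (\<lambda>_. - (2 * a * a1 / 9) * fst e - a1 / 3 * fst (snd (snd (snd e))))"
  "dderiv e (eta_v (sym_field a b c a1 a2 a3 a4 a5)) = (\<lambda>_. - (2 * a1 / 3) * snd (snd (snd (snd e))))"
proof -
  show "dderiv e (xi_x (sym_field a b c a1 a2 a3 a4 a5)) = (\<lambda>_. a1 / 3 * fst e)"
    unfolding sym_field_components
    by (intro ext dderiv_eqI[where f' = "\<lambda>h. a1 / 3 * fst h"])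
      (auto intro!: derivative_eq_intros simp: algebra_simps)
  show "dderiv e (xi_y (sym_field a b c a1 a2 a3 a4 a5)) = (\<lambda>_. a1 / 3 * fst (snd e))"
    unfolding sym_field_components
    by (intro ext dderiv_eqI[where f' = "\<lambda>h. a1 / 3 * fst (snd h)"])
      (auto intro!: derivative_eq_intros simp: algebra_simps)
  show "dderiv e (xi_t (sym_field a b c a1 a2 a3 a4 a5)) = (\<lambda>_. a1 * fst (snd (snd e)))"
    unfolding sym_field_components
    by (intro ext dderiv_eqI[where f' = "\<lambda>h. a1 * fst (snd (snd h))"])
      (auto intro!: derivative_eq_intros simp: algebra_simps)
  show "dderiv e (eta_u (sym_field a b c a1 a2 a3 a4 a5)) = (\<lambda>_. - (2 * a * a1 / 9) * fst e - a1 / 3 * fst (snd (snd (snd e))))"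
    unfolding sym_field_components
    by (intro ext dderiv_eqI[where f' = "\<lambda>h. - (2 * a * a1 / 9) * fst h - a1 / 3 * fst (snd (snd (snd h)))"])
      (auto intro!: derivative_eq_intros simp: algebra_simps)
  show "dderiv e (eta_v (sym_field a b c a1 a2 a3 a4 a5)) = (\<lambda>_. - (2 * a1 / 3) * snd (snd (snd (snd e))))"
    unfolding sym_field_components
    by (intro ext dderiv_eqI[where f' = "\<lambda>h. - (2 * a1 / 3) * snd (snd (snd (snd h)))"])
      (auto intro!: derivative_eq_intros simp: algebra_simps)
qed

lemma projectable_sym_field: "projectable_field (sym_field a b c a1 a2 a3 a4 a5)"
proof
  show "smooth_on UNIV (sym_field a b c a1 a2 a3 a4 a5)"
    using has_derivative_sym_field[OF c] smooth_on_affine by blast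
qed (simp_all add: dderiv_components coord_dir.simps)

text \<open>Under \<open>v1\<close> the weights of x, y, t, u, v are 1/3, 1/3, 1, -1/3, -2/3. The
  terms with a and b have weight -1 instead of -5/3; the shift -2ax/9 of u, acting through -3 u_x
  u_xy, and the shift -b/(9c) of v, acting through -6cv u_yy, make up the difference.\<close>

lemma Pr4_sym_field:
  "Pr4 (sym_field a b c a1 a2 a3 a4 a5) (Delta1 a b c) j = - (5 * a1 / 3) * Delta1 a b c j"
  "Pr4 (sym_field a b c a1 a2 a3 a4 a5) Delta2 j = - a1 * Delta2 j"
proof -
  interpret projectable_field "sym_field a b c a1 a2 a3 a4 a5"
    by (rule projectable_sym_field)
  show "Pr4 (sym_field a b c a1 a2 a3 a4 a5) (Delta1 a b c) j = - (5 * a1 / 3) * Delta1 a b c j"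
    unfolding Pr4_Delta1 Delta1_def Let_def numeral_2_eq_2 numeral_3_eq_3 numeral_4_eq_4 One_nat_def prolong_u
    using c by (simp add: dderiv_components coord_dir.simps)
      (simp add: sym_field_components(5) base_def field_simps)
  show "Pr4 (sym_field a b c a1 a2 a3 a4 a5) Delta2 j = - a1 * Delta2 j"
    unfolding Pr4_Delta2_eq[OF smooth_Z] base_total_deriv_def Delta2_def
    by (simp add: dderiv_components coord_dir.simps) (simp add: field_simps)
qed

lemma sym_field_in_L5: "sym_field a b c a1 a2 a3 a4 a5 \<in> L5 a b c"
proof -
  have "infinitesimal_symmetry a b c (sym_field a b c a1 a2 a3 a4 a5)"
    using projectable_field.smooth_Z[OF projectable_sym_field]
    by (auto simp: infinitesimal_symmetry_def Pr4_sym_field is_solution_def)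
  then show ?thesis
    by (auto simp: L5_def F1_def F2_def F3_def sym_field_components constant_on_def)
qed

lemma L5_eq: "L5 a b c = {sym_field a b c a1 a2 a3 a4 a5 | a1 a2 a3 a4 a5. True}"
proof -
  have "\<exists>a1 a2 a3 a4 a5. Z = sym_field a b c a1 a2 a3 a4 a5" if "Z \<in> L5 a b c" for Z
  proof -
    interpret blmp_symmetry Z a b c
      using that c by unfold_locales (auto simp: L5_def)
    show ?thesis
      using general_form that by (auto simp: L5_def sym_field_def)
  qed
  then show ?thesis
    using sym_field_in_L5 by blast
qed

lemma L5_cases:
  assumes "Z \<in> L5 a b c"
  obtains a1 a2 a3 a4 a5 where "Z = sym_field a b c a1 a2 a3 a4 a5"
  using assms L5_eq by blast

lemma sym_field_add:
  "sym_field a b c a1 a2 a3 a4 a5 + sym_field a b c b1 b2 b3 b4 b5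
    = sym_field a b c (a1 + b1) (a2 + b2) (a3 + b3) (a4 + b4) (a5 + b5)"
  by (auto simp: sym_field_def vf.scale_left_distrib)

lemma sym_field_scale:
  "vf_scale r (sym_field a b c a1 a2 a3 a4 a5) = sym_field a b c (r * a1) (r * a2) (r * a3) (r * a4) (r * a5)"
  by (auto simp: sym_field_def vf.scale_right_distrib)

lemma sym_field_zero: "0 = sym_field a b c 0 0 0 0 0"
  by (simp add: sym_field_def)

lemma sym_field_inject:
  "sym_field a b c a1 a2 a3 a4 a5 = sym_field a b c b1 b2 b3 b4 b5 \<longleftrightarrow>
    a1 = b1 \<and> a2 = b2 \<and> a3 = b3 \<and> a4 = b4 \<and> a5 = b5"
proof
  assume *: "sym_field a b c a1 a2 a3 a4 a5 = sym_field a b c b1 b2 b3 b4 b5"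
  show "a1 = b1 \<and> a2 = b2 \<and> a3 = b3 \<and> a4 = b4 \<and> a5 = b5"
    \<comment> \<open>The x, y and t components at the origin give the parameters 3, 4 and 2, and
      the u component gives 5. The t component at t = 1 then gives the first.\<close>
    using fun_cong[OF *, of "(0, 0, 0, 0, 0)"] fun_cong[OF *, of "(0, 0, 1, 0, 0)"]
    unfolding sym_field_eq[OF c] by simp
qed simp

text \<open>The linear parts are multiples of one matrix and commute, so the bracket is a constant
  field. Its v component vanishes because the v components of the two fields are
  proportional.\<close>

lemma lie_bracket_sym_field:
  "lie_bracket (sym_field a b c a1 a2 a3 a4 a5) (sym_field a b c b1 b2 b3 b4 b5) =
    sym_field a b c 0 (b1 * a2 - a1 * b2) ((b1 * a3 - a1 * b3) / 3) ((b1 * a4 - a1 * b4) / 3)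
      (- (2 * a / 9) * (b1 * a3 - a1 * b3) - (b1 * a5 - a1 * b5) / 3)"
proof -
  have "frechet_derivative (sym_field a b c a1 a2 a3 a4 a5) (at p) = sym_field_lin a a1" for p a1 a2 a3 a4 a5
    using frechet_derivative_at[OF has_derivative_sym_field[OF c]] by metis
  then show ?thesis
    by (simp add: lie_bracket_def sym_field_lin_def sym_field_eq[OF c])
      (auto simp: field_simps)
qed

lemma lie_algebra_L5: "lie_algebra (L5 a b c)"
  unfolding lie_algebra_def
proof (intro conjI ballI allI)
  show "vf.subspace (L5 a b c)"
    unfolding vf.subspace_def
    by (auto elim!: L5_cases simp: sym_field_add sym_field_scale sym_field_zero sym_field_in_L5)
qed (auto elim!: L5_cases simp: lie_bracket_sym_field sym_field_add sym_field_scale sym_field_zero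
    sym_field_in_L5 sym_field_inject field_simps)

lemma basis_eq:
  "v1 a b c = sym_field a b c 1 0 0 0 0" "v2 = sym_field a b c 0 1 0 0 0" "v3 = sym_field a b c 0 0 1 0 0"
  "v4 = sym_field a b c 0 0 0 1 0" "v5 = sym_field a b c 0 0 0 0 1"
  by (simp_all add: sym_field_def)

lemma distinct_basis: "distinct [v1 a b c, v2, v3, v4, v5]"
  by (simp add: basis_eq sym_field_inject)

lemma sum_basis:
  "(\<Sum>Z\<in>{v1 a b c, v2, v3, v4, v5}. vf_scale (k Z) Z) = sym_field a b c (k (v1 a b c)) (k v2) (k v3) (k v4) (k v5)"
  using distinct_basis by (simp add: sym_field_def add.assoc)

lemma span_basis: "vf.span {v1 a b c, v2, v3, v4, v5} = L5 a b c"
proof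
  show "vf.span {v1 a b c, v2, v3, v4, v5} \<subseteq> L5 a b c"
    by (auto simp: vf.span_finite sum_basis sym_field_in_L5)
  show "L5 a b c \<subseteq> vf.span {v1 a b c, v2, v3, v4, v5}"
  proof
    fix Z
    assume "Z \<in> L5 a b c"
    then obtain a1 a2 a3 a4 a5 where "Z = sym_field a b c a1 a2 a3 a4 a5"
      by (rule L5_cases)
    then show "Z \<in> vf.span {v1 a b c, v2, v3, v4, v5}"
      by (simp only: sym_field_def) (intro vf.span_add vf.span_scale vf.span_base; simp)
  qed
qed

lemma independent_basis: "vf.independent {v1 a b c, v2, v3, v4, v5}"
proof -
  have "vf.dependent {v1 a b c, v2, v3, v4, v5} \<longleftrightarrow>
    (\<exists>k. (\<exists>Z\<in>{v1 a b c, v2, v3, v4, v5}. k Z \<noteq> 0) \<and> (\<Sum>Z\<in>{v1 a b c, v2, v3, v4, v5}. vf_scale (k Z) Z) = 0)"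
    by (rule vf.dependent_finite) simp
  then show ?thesis
    unfolding sum_basis sym_field_zero sym_field_inject by auto
qed

end

theorem theorem2p1:
  fixes a b c :: real
  assumes "a \<noteq> 0" and "b \<noteq> 0" and "c \<noteq> 0"
  shows "lie_algebra (L5 a b c) \<and>
    vf.dim (L5 a b c) = 5 \<and>
    vf.span {v1 a b c, v2, v3, v4, v5} = L5 a b c \<and>
    distinct [v1 a b c, v2, v3, v4, v5] \<and>
    vf.independent {v1 a b c, v2, v3, v4, v5} \<and>
    (\<forall>Z \<in> L5 a b c. \<exists>a1 a2 a3 a4 a5 :: real.
       Z = vf_scale a1 (v1 a b c) + vf_scale a2 v2 + vf_scale a3 v3
             + vf_scale a4 v4 + vf_scale a5 v5)"
proof -
  note c = \<open>c \<noteq> 0\<close>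
  have "card {v1 a b c, v2, v3, v4, v5} = 5"
    using distinct_card[OF distinct_basis[OF c], of a b] by simp
  then have "vf.dim (L5 a b c) = 5"
    using vf.dim_eq_card_independent[OF independent_basis[OF c]] vf.dim_span span_basis[OF c] by metis
  moreover have "\<exists>a1 a2 a3 a4 a5. Z = vf_scale a1 (v1 a b c) + vf_scale a2 v2 + vf_scale a3 v3
      + vf_scale a4 v4 + vf_scale a5 v5" if "Z \<in> L5 a b c" for Z
    using L5_cases[OF c that] unfolding sym_field_def by metis
  ultimately show ?thesis
    by (intro conjI ballI lie_algebra_L5 span_basis distinct_basis independent_basis c)
qed

end
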